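(* Quantum theory does not admit any post-selection free $n$-cycle paradoxes (for any $n\ge 3$).
   Context: **Theory.** A theory $\mathbb{T}$ has systems, states of systems, transformations of systems (including the identity), measurements with classical outcomes, a notion of time ordering operations, and a rule assigning to outcomes of measurements in a given scenario nonnegative normalised probabilities obeying the standard rules of conditional probability. Each measurement $\mathcal{M}_i$ has two models in $\mathbb{T}$, labelled by a setting $s_i\in\{0,1\}$: $s_i=1$ means it is modelled as producing classical records, $s_i=0$ means it is modelled purely as an evolution of systems of $\mathbb{T}$. **Multi-agent setup.** A multi-agent setup $\mathcal{MA}$ in $\mathbb{T}$ consists of: a finite set of agents $A_1,\dots,A_N$; a finite set of systems $\mathcal{S}=\{S_1,\dots,S_m\}$; for each $A_i$ a further system $L_i$ (its memory/lab), initialised to a fixed state $\rho^0_{L_i}$, with $\mathcal{L}=\{L_i\}_{i=1}^N$; measurements $\mathcal{M}_1,\dots,\mathcal{M}_N$, where $\mathcal{M}_i$ is performed by $A_i$ at time $t_i$ on some subset of $\mathcal{S}\cup\mathcal{L}\setminus\{L_i\}$, its result being stored in $L_i$, with $t_i<t_j$ for $i<j$; for each $A_i$ a finite set $\mathtt{O}_i$ of values of its outcome; an initial joint state of $S_1,\dots,S_m$ prepared at a time $t_0<t_i$ for all $i$. Measurements are regarded as acting on $\mathcal{S}\cup\mathcal{L}$ by appending identities. **Notation.** A set of outcomes $a_{j_1},\dots,a_{j_p}$ is written as a vector $\vec{a}_j$, and $\vec{a}_j=\vec{v}_j$ means that the values $\vec{v}_j$ are assigned to it; $\vec{a}_j=\neg\vec{v}_j$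 denotes the negation of $\vec{a}_j=\vec{v}_j$. **Default prediction.** A default prediction is a conditional probability $P(\vec{a}_j|\vec{a}_l,\vec{s})$, for outcomes $\vec{a}_j,\vec{a}_l$ of disjoint subsets of measurements ($\vec{a}_j$ non-empty, $\vec{a}_l$ possibly empty), where $\vec{s}=(s_1,\dots,s_N)$ has $s_i=1$ if the outcome of $A_i$ is in $\vec{a}_j\cup\vec{a}_l$ and $s_i=0$ otherwise, computed by the probability rule of $\mathbb{T}$ for the setup and these settings. **Statements.** The set $\Sigma_{\mathcal{MA}}$ consists of: atomic outcome statements $(\vec{a}_j=\vec{v}_j)_{\vec{s}}$ whenever the default prediction satisfies $P(\vec{a}_j=\vec{v}_j|\vec{s})>0$; and atomic inferences $\big((\vec{a}_l=\vec{v}_l)\Rightarrow(\vec{a}_j=\vec{v}_j)\big)_{\vec{s}}$ whenever the default prediction satisfies $P(\vec{a}_j=\vec{v}_j|\vec{a}_l=\vec{v}_l,\vec{s})=1$, or equivalently $P(\vec{a}_j=\neg\vec{v}_j,\vec{a}_l=\vec{v}_l|\vec{s})=0$. The setting-unlabelled version of a statement is obtained by deleting the subscript $\vec{s}$. **Joint measurability.** Measurements $\mathcal{M}_1,\dots,\mathcal{M}_k$ with outcome sets $O_1,\dots,O_k$ on a set of systems are compatible (jointly measurable) if for every initial state $\rho$ there is a measurement with outcome set $O_1\times\dots\times O_k$ whose distribution $P(a_1,\dots,a_k|\rho)$ has, for each $i$, marginal on $a_i$ equal to the distribution of $a_i$ when only $\mathcal{M}_i$ is performed on $\rho$. **Compatibility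 in a setup.** Let $\rho$ be the joint initial state of $\mathcal{S}\cup\mathcal{L}$. A subset $\{\mathcal{M}_{j_1},\dots,\mathcal{M}_{j_p}\}$ of the measurements of $\mathcal{MA}$ (and the corresponding set of agents) is compatible in $\mathcal{MA}$ if there exist measurements $\mathcal{M}'_{j_k}$ on $\mathcal{S}\cup\mathcal{L}$ with the same outcomes $a_{j_k}$, such that (i) the default prediction satisfies $P(a_{j_1},\dots,a_{j_p}|\vec{s})=P(a_{j_1},\dots,a_{j_p}|\rho,\{\mathcal{M}'_{j_k}\}_{k=1}^p)$, the right-hand side being the probability of applying the primed measurements to $\rho$, and the single-outcome marginals of the two sides agree; (ii) the primed measurements are jointly measurable. **Knowledge.** $K_i\phi$ means agent $A_i$ knows $\phi$. Agents reason with the distribution axiom $(K_i\phi\wedge K_i(\phi\Rightarrow\psi))\Rightarrow K_i(\phi\wedge(\phi\Rightarrow\psi))\Rightarrow K_i\psi$. The trust rule is $K_iK_j\phi\Rightarrow K_i\phi$ ($A_i$ trusts $A_j$). **Multi-agent paradox.** The four assumptions are: 1. (common knowledge) All conclusions of agents are based on the common theory $\mathbb{T}$ and the same setup $\mathcal{MA}$, which are common knowledge. 2. (reasoning about compatible agents) Two agents $A,B$ can apply the trust rule to statements $\phi_{\vec{s}}$ of the setup, $K_AK_B\phi_{\vec{s}}\Rightarrow K_A\phi_{\vec{s}}$, only when $A$ and $B$ are compatible; and agents can only reason using statements $\phi_{\vec{s}}$ of the setup (atomic outcome statements or atomic inferences) such that the set of all outcomes appearing in $\phi_{\vec{s}}$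 belongs to a compatible set of measurements. 3. (setting-independence) Every $\phi_{\vec{s}}\in\Sigma_{\mathcal{MA}}$ can be replaced by its setting-unlabelled version $\phi$. 4. (non-contradictory outcomes) There is no agent $A$ with $K_A(\vec{a}_j=\vec{v}_j\wedge\vec{a}_j=\neg\vec{v}_j)$ for some value assignment $\vec{v}_j$ to a set $\vec{a}_j$ of outcomes in the setup. If $\mathbb{T}$ includes a multi-agent setup for which these four cannot hold simultaneously, $\mathbb{T}$ admits (entails) a multi-agent paradox. **Quantum instance.** In quantum theory all measurements are taken to be projective, $s_i=0$ is the unitary description of the measurement acting on the measured systems and the memory, $s_i=1$ means the measurement projectors are applied, and probabilities are given by the Born rule. Compatibility of agents is instantiated as commutativity of the projectors of their (primed) measurements; after dropping settings, the default prediction for compatible outcomes is computed from the primed projectors $\pi$ on the initial state $\rho$, e.g. $P(a=1,b=1)=\mathrm{Tr}(\pi_a^1\pi_b^1\rho)$. **Post-selection free $n$-cycle paradox.** Consider a multi-agent setup with $n$ agents, where agent $A_i$ has outcome $x_i\in\{0,1\}$ and only adjacent pairs of agents $(A_1,A_2),(A_2,A_3),\dots,(A_{n-1},A_n),(A_n,A_1)$ are compatible. A post-selection free $n$-cycle paradox is any multi-agent paradox in such a setup in which agents reasoning with the four assumptions of a multi-agent paradox (common knowledge, reasoning about compatible agents, setting-independence, non-contradictory outcomes) obtain, for some $i\in\{1,\dots,n\}$, the two chains of inferences $$x_i=0\Rightarrow x_{i+1}=v_{i+1}\Rightarrow x_{i+2}=v_{i+2}\Rightarrow\dots\Rightarrow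 x_{i-1}=v_{i-1}\Rightarrow x_i=1,$$ $$x_i=1\Rightarrow x_{i+1}=v'_{i+1}\Rightarrow x_{i+2}=v'_{i+2}\Rightarrow\dots\Rightarrow x_{i-1}=v'_{i-1}\Rightarrow x_i=0,$$ where $v_j,v'_j\in\{0,1\}$ and $v_j\neq v'_j$ for each $j\neq i$ in $\{1,\dots,n\}$, indices being modulo $n$. *)

theory Defs
  imports "HOL-Analysis.Analysis"
begin

section \<open>Hilbert spaces, operators and states\<close>

text \<open>
  A Hilbert space with an orthonormal basis labelled by the set \<open>X\<close> is represented by the
  square-summable functions supported on \<open>X\<close>.  No finiteness is assumed, so Hilbert spaces of any
  dimension are covered.  Operators are functions on vectors, of which only the behaviour on
  \<open>ell2 X\<close> matters.
\<close>

type_synonym 'x vec = "'x \<Rightarrow> complex"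
type_synonym 'x oper = "'x vec \<Rightarrow> 'x vec"

definition ell2 :: "'x set \<Rightarrow> 'x vec set" where
  "ell2 X = {f. (\<forall>x. x \<notin> X \<longrightarrow> f x = 0) \<and> (\<lambda>x. (cmod (f x))\<^sup>2) summable_on X}"

definition inner2 :: "'x set \<Rightarrow> 'x vec \<Rightarrow> 'x vec \<Rightarrow> complex" where
  "inner2 X f g = (\<Sum>\<^sub>\<infinity>x\<in>X. cnj (f x) * g x)"

definition ket :: "'x \<Rightarrow> 'x vec" where
  "ket x = (\<lambda>y. if y = x then 1 else 0)"

definition linear_operator :: "'x set \<Rightarrow> 'x oper \<Rightarrow> bool" where
  "linear_operator X A \<longleftrightarrow>
     (\<forall>f\<in>ell2 X. A f \<in> ell2 X) \<and>
     (\<forall>f\<in>ell2 X. \<forall>g\<in>ell2 X. \<forall>a b. A (\<lambda>x. a * f x + b * g x) = (\<lambda>x. a * A f x + b * A g x))"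

definition unitary_operator :: "'x set \<Rightarrow> 'x oper \<Rightarrow> bool" where
  "unitary_operator X U \<longleftrightarrow>
     linear_operator X U \<and> bij_betw U (ell2 X) (ell2 X) \<and>
     (\<forall>f\<in>ell2 X. \<forall>g\<in>ell2 X. inner2 X (U f) (U g) = inner2 X f g)"

text \<open>
  Boundedness need not be required of projectors and of density operators: operators that are
  symmetric on the whole space are bounded (Hellinger and Toeplitz).
\<close>

definition projector :: "'x set \<Rightarrow> 'x oper \<Rightarrow> bool" where
  "projector X P \<longleftrightarrow>
     linear_operator X P \<and> (\<forall>f\<in>ell2 X. P (P f) = P f) \<and>
     (\<forall>f\<in>ell2 X. \<forall>g\<in>ell2 X. inner2 X (P f) g = inner2 X f (P g))"

definition projective_measurement :: "'x set \<Rightarrow> 'o set \<Rightarrow> ('o \<Rightarrow> 'x oper) \<Rightarrow> bool" where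
  "projective_measurement X Out P \<longleftrightarrow>
     finite Out \<and> (\<forall>a\<in>Out. projector X (P a)) \<and>
     (\<forall>a\<in>Out. \<forall>b\<in>Out. a \<noteq> b \<longrightarrow> (\<forall>f\<in>ell2 X. P a (P b f) = (\<lambda>x. 0))) \<and>
     (\<forall>f\<in>ell2 X. (\<lambda>x. \<Sum>a\<in>Out. P a f x) = f)"

text \<open>
  The trace of a positive operator is the sum of its diagonal entries \<open>\<langle>x|A|x\<rangle> = A (ket x) x\<close>, taken
  in \<open>[0,\<infinity>]\<close>; it is applied to positive operators only.
\<close>

definition trace_pos :: "'x set \<Rightarrow> 'x oper \<Rightarrow> ennreal" where
  "trace_pos X A = (\<Sum>\<^sub>\<infinity>x\<in>X. ennreal (Re (A (ket x) x)))"

definition density_operator :: "'x set \<Rightarrow> 'x oper \<Rightarrow> bool" where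
  "density_operator X \<rho> \<longleftrightarrow>
     linear_operator X \<rho> \<and>
     (\<forall>f\<in>ell2 X. inner2 X f (\<rho> f) \<in> \<real> \<and> 0 \<le> Re (inner2 X f (\<rho> f))) \<and>
     trace_pos X \<rho> = 1"

definition conj_unitary :: "'x set \<Rightarrow> 'x oper \<Rightarrow> 'x oper \<Rightarrow> 'x oper" where
  "conj_unitary X U \<sigma> = U \<circ> \<sigma> \<circ> inv_into (ell2 X) U"

definition conj_projector :: "'x oper \<Rightarrow> 'x oper \<Rightarrow> 'x oper" where
  "conj_projector P \<sigma> = P \<circ> \<sigma> \<circ> P"


section \<open>Composite systems\<close>

datatype sys = S nat | L nat

text \<open>
  A set \<open>R\<close> of systems whose members have orthonormal bases \<open>bs s\<close> has the product basis
  \<open>PiE R bs\<close>; this realises the Hilbert space tensor product.  For \<open>R \<subseteq> W\<close>, \<open>append_id bs W R A\<close> is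
  the operator \<open>A\<close> on \<open>R\<close>, tensored with the identity on \<open>W - R\<close>: it acts on each function of the
  \<open>R\<close>-coordinates obtained by fixing the other coordinates.
\<close>

definition append_id ::
  "(sys \<Rightarrow> 'b set) \<Rightarrow> sys set \<Rightarrow> sys set \<Rightarrow> (sys \<Rightarrow> 'b) oper \<Rightarrow> (sys \<Rightarrow> 'b) oper" where
  "append_id bs W R A = (\<lambda>f x.
     if x \<in> PiE W bs
     then A (\<lambda>u. if u \<in> PiE R bs then f (override_on x u R) else 0) (restrict x R)
     else 0)"


section \<open>Multi-agent setups in quantum theory\<close>

text \<open>
  Agents are the numbers \<open>1, \<dots>, num_agents\<close>; outcome values are encoded as natural numbers.
  \<open>meas i a\<close> is the projector of outcome \<open>a\<close> of the measurement of agent \<open>i\<close>, an operator on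
  \<open>target i\<close>; \<open>evol i\<close> is the unitary description of that measurement, an operator on
  \<open>target i \<union> {L i}\<close>.  \<open>tm 0\<close> is the preparation time.
\<close>

record 'b multi_agent_setup =
  num_agents :: nat
  num_sys :: nat
  bas :: "sys \<Rightarrow> 'b set"
  init :: "(sys \<Rightarrow> 'b) oper"
  mem0 :: "nat \<Rightarrow> (sys \<Rightarrow> 'b) oper"
  tm :: "nat \<Rightarrow> real"
  target :: "nat \<Rightarrow> sys set"
  outs :: "nat \<Rightarrow> nat set"
  meas :: "nat \<Rightarrow> nat \<Rightarrow> (sys \<Rightarrow> 'b) oper"
  evol :: "nat \<Rightarrow> (sys \<Rightarrow> 'b) oper"

definition agents :: "'b multi_agent_setup \<Rightarrow> nat set" where
  "agents MA = {1..num_agents MA}"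

definition main_systems :: "'b multi_agent_setup \<Rightarrow> sys set" where
  "main_systems MA = S ` {1..num_sys MA}"

definition all_systems :: "'b multi_agent_setup \<Rightarrow> sys set" where
  "all_systems MA = main_systems MA \<union> L ` agents MA"

definition space_of :: "'b multi_agent_setup \<Rightarrow> sys set \<Rightarrow> (sys \<Rightarrow> 'b) set" where
  "space_of MA R = PiE R (bas MA)"

definition total_space :: "'b multi_agent_setup \<Rightarrow> (sys \<Rightarrow> 'b) set" where
  "total_space MA = space_of MA (all_systems MA)"

text \<open>
  The unitary \<open>evol i\<close> coherently copies the outcome to the memory: on vectors whose memory part
  is in the support of the initial memory state it is \<open>\<Sum>a. \<pi> a \<otimes> V a\<close>, where the \<open>V a\<close> are
  unitaries of the memory that lead to perfectly distinguishable memory states, i.e. states told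
  apart by a projective measurement \<open>R\<close> of the memory.
\<close>

definition unitary_description :: "'b multi_agent_setup \<Rightarrow> nat \<Rightarrow> bool" where
  "unitary_description MA i \<longleftrightarrow>
     (let M = {L i}; W = target MA i \<union> M; ext = append_id (bas MA) W in
      unitary_operator (space_of MA W) (evol MA i) \<and>
      (\<exists>V R.
         (\<forall>a\<in>outs MA i. unitary_operator (space_of MA M) (V a)) \<and>
         projective_measurement (space_of MA M) (outs MA i) R \<and>
         (\<forall>a\<in>outs MA i. \<forall>b\<in>outs MA i. \<forall>f\<in>ell2 (space_of MA M).
            R a (V b (mem0 MA i f)) = (if a = b then V b (mem0 MA i f) else (\<lambda>x. 0))) \<and>
         (\<forall>f\<in>ell2 (space_of MA W).
            evol MA i (ext M (mem0 MA i) f) =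
              (\<lambda>x. \<Sum>a\<in>outs MA i.
                 ext (target MA i) (meas MA i a) (ext M (V a) (ext M (mem0 MA i) f)) x))))"

text \<open>
  The joint initial state is the tensor product of a state of the main systems with the initial
  memory states.
\<close>

definition quantum_setup :: "'b multi_agent_setup \<Rightarrow> bool" where
  "quantum_setup MA \<longleftrightarrow>
     density_operator (total_space MA) (init MA) \<and>
     (\<forall>i\<in>agents MA. density_operator (space_of MA {L i}) (mem0 MA i)) \<and>
     (\<exists>\<rho>. density_operator (space_of MA (main_systems MA)) \<rho> \<and>
        (\<forall>f\<in>ell2 (total_space MA).
           init MA f =
             foldr (\<lambda>i. (\<circ>) (append_id (bas MA) (all_systems MA) {L i} (mem0 MA i)))
               [1..<Suc (num_agents MA)]
               (append_id (bas MA) (all_systems MA) (main_systems MA) \<rho>) f)) \<and>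
     strict_mono_on {0..num_agents MA} (tm MA) \<and>
     (\<forall>i\<in>agents MA.
        target MA i \<subseteq> all_systems MA - {L i} \<and>
        projective_measurement (space_of MA (target MA i)) (outs MA i) (meas MA i) \<and>
        unitary_description MA i)"


section \<open>Default predictions\<close>

text \<open>
  With \<open>s i = 1\<close> the measurement projectors of agent \<open>i\<close> are applied and the result is then stored
  in the memory by \<open>evol i\<close>; with \<open>s i = 0\<close> there is only the unitary evolution.  States are
  not normalised, so the trace of the final one is the Born probability of the outcomes \<open>w\<close> of
  the agents with \<open>s i = 1\<close>.
\<close>

definition step ::
  "'b multi_agent_setup \<Rightarrow> (nat \<Rightarrow> nat) \<Rightarrow> (nat \<Rightarrow> nat) \<Rightarrow> nat \<Rightarrow> (sys \<Rightarrow> 'b) oper \<Rightarrow> (sys \<Rightarrow> 'b) oper" where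
  "step MA s w i \<sigma> =
     (let ext = append_id (bas MA) (all_systems MA) in
      conj_unitary (total_space MA) (ext (target MA i \<union> {L i}) (evol MA i))
        (if s i = 1 then conj_projector (ext (target MA i) (meas MA i (w i))) \<sigma> else \<sigma>))"

definition joint_prob :: "'b multi_agent_setup \<Rightarrow> (nat \<Rightarrow> nat) \<Rightarrow> (nat \<Rightarrow> nat) \<Rightarrow> ennreal" where
  "joint_prob MA s w =
     trace_pos (total_space MA) (fold (step MA s w) [1..<Suc (num_agents MA)] (init MA))"

definition prob :: "'b multi_agent_setup \<Rightarrow> (nat \<Rightarrow> nat) \<Rightarrow> ((nat \<Rightarrow> nat) \<Rightarrow> bool) \<Rightarrow> ennreal" where
  "prob MA s E =
     (\<Sum>w | w \<in> PiE {i \<in> agents MA. s i = 1} (outs MA) \<and> E w. joint_prob MA s w)"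

text \<open>
  A value assignment to a set of outcomes is a partial map from agents to values, its domain being
  the set of agents whose outcomes are concerned.
\<close>

type_synonym asg = "nat \<Rightarrow> nat option"

definition valid_asg :: "'b multi_agent_setup \<Rightarrow> asg \<Rightarrow> bool" where
  "valid_asg MA v \<longleftrightarrow> dom v \<subseteq> agents MA \<and> (\<forall>i\<in>dom v. the (v i) \<in> outs MA i)"

definition holds :: "asg \<Rightarrow> (nat \<Rightarrow> nat) \<Rightarrow> bool" where
  "holds v w \<longleftrightarrow> (\<forall>i\<in>dom v. v i = Some (w i))"

definition default_settings :: "nat set \<Rightarrow> nat \<Rightarrow> nat" where
  "default_settings J = (\<lambda>i. if i \<in> J then 1 else 0)"

definition default_prediction :: "'b multi_agent_setup \<Rightarrow> asg \<Rightarrow> asg \<Rightarrow> ennreal" where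
  "default_prediction MA j l =
     (let s = default_settings (dom j \<union> dom l) in
      prob MA s (\<lambda>w. holds j w \<and> holds l w) / prob MA s (holds l))"


section \<open>Compatibility\<close>

text \<open>
  For commuting projectors \<open>\<pi>, \<dots>, \<pi>'\<close> the trace below equals \<open>Tr (\<pi> \<cdots> \<pi>' \<rho>)\<close>, the sandwiched form
  being manifestly positive.
\<close>

definition primed_prob ::
  "'b multi_agent_setup \<Rightarrow> nat set \<Rightarrow> (nat \<Rightarrow> nat \<Rightarrow> (sys \<Rightarrow> 'b) oper) \<Rightarrow> (nat \<Rightarrow> nat) \<Rightarrow> ennreal" where
  "primed_prob MA J P w =
     trace_pos (total_space MA)
       (fold (\<lambda>i. conj_projector (P i (w i))) (sorted_list_of_set J) (init MA))"

text \<open>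
  In the third condition the single-outcome default prediction is the one with only the setting
  of agent \<open>i\<close> equal to 1; the last condition is joint measurability.
\<close>

definition compatible :: "'b multi_agent_setup \<Rightarrow> nat set \<Rightarrow> bool" where
  "compatible MA J \<longleftrightarrow> J \<subseteq> agents MA \<and>
     (\<exists>P.
        (\<forall>i\<in>J. projective_measurement (total_space MA) (outs MA i) (P i)) \<and>
        (\<forall>w\<in>PiE J (outs MA). joint_prob MA (default_settings J) w = primed_prob MA J P w) \<and>
        (\<forall>i\<in>J. \<forall>a\<in>outs MA i.
           joint_prob MA (default_settings {i}) (\<lambda>_. a) = primed_prob MA {i} P (\<lambda>_. a)) \<and>
        (\<forall>i\<in>J. \<forall>k\<in>J. i \<noteq> k \<longrightarrow>
           (\<forall>a\<in>outs MA i. \<forall>b\<in>outs MA k. \<forall>f\<in>ell2 (total_space MA).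
              P i a (P k b f) = P k b (P i a f))))"


section \<open>Statements and reasoning\<close>

text \<open>
  \<open>Is v\<close> and \<open>Is_not v\<close> say that the assignment \<open>v\<close> holds, respectively does not hold;
  \<open>At \<phi> s\<close> is \<open>\<phi>\<close> labelled with the settings \<open>s\<close>.
\<close>

datatype fm =
    Is asg
  | Is_not asg
  | And fm fm
  | Imp fm fm
  | At fm "nat \<Rightarrow> nat"

fun outcomes_in :: "fm \<Rightarrow> nat set" where
  "outcomes_in (Is v) = dom v"
| "outcomes_in (Is_not v) = dom v"
| "outcomes_in (And \<phi> \<psi>) = outcomes_in \<phi> \<union> outcomes_in \<psi>"
| "outcomes_in (Imp \<phi> \<psi>) = outcomes_in \<phi> \<union> outcomes_in \<psi>"
| "outcomes_in (At \<phi> s) = outcomes_in \<phi>"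

definition outcome_statements :: "'b multi_agent_setup \<Rightarrow> fm set" where
  "outcome_statements MA =
     {At (Is v) s | v s.
        valid_asg MA v \<and> dom v \<noteq> {} \<and> s = default_settings (dom v) \<and> prob MA s (holds v) > 0}"

text \<open>
  The two alternatives in the last line are equivalent when the premise has positive probability.
  If it has probability 0, only the second one is satisfied.
\<close>

definition atomic_inferences :: "'b multi_agent_setup \<Rightarrow> fm set" where
  "atomic_inferences MA =
     {At (Imp (Is l) (Is j)) s | l j s.
        valid_asg MA l \<and> valid_asg MA j \<and> dom j \<noteq> {} \<and> dom l \<inter> dom j = {} \<and>
        s = default_settings (dom j \<union> dom l) \<and>
        (default_prediction MA j l = 1 \<or> prob MA s (\<lambda>w. \<not> holds j w \<and> holds l w) = 0)}"

definition usable :: "'b multi_agent_setup \<Rightarrow> fm \<Rightarrow> bool" where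
  "usable MA \<phi> \<longleftrightarrow> (\<exists>J. compatible MA J \<and> outcomes_in \<phi> \<subseteq> J)"

text \<open>
  \<open>knows MA \<Omega> [A, B, \<dots>] \<phi>\<close> means that \<open>K_A K_B \<dots> \<phi>\<close> is obtained in a run in which the atomic
  outcome statements in \<open>\<Omega>\<close> are the case.  The atomic inferences follow from the theory and the
  systems, states and measurements of \<open>MA\<close>, which are common knowledge; an outcome statement is known to the agents whose outcomes it
  concerns; that outcomes are stored in the memories of the agents is part of the common knowledge
  (rule \<open>stored\<close>).  Distribution is split into its two steps \<open>conj\<close> and \<open>detach\<close>.
\<close>

inductive knows :: "'b multi_agent_setup \<Rightarrow> fm set \<Rightarrow> nat list \<Rightarrow> fm \<Rightarrow> bool" for MA \<Omega> where
  inference: "\<lbrakk>\<phi> \<in> atomic_inferences MA; usable MA \<phi>; p \<noteq> []; set p \<subseteq> agents MA\<rbrakk>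
    \<Longrightarrow> knows MA \<Omega> p \<phi>"
| outcome: "\<lbrakk>\<phi> \<in> outcome_statements MA; \<phi> \<in> \<Omega>; usable MA \<phi>; p \<noteq> []; set p \<subseteq> outcomes_in \<phi>\<rbrakk>
    \<Longrightarrow> knows MA \<Omega> p \<phi>"
| unlabel: "knows MA \<Omega> p (At \<phi> s) \<Longrightarrow> knows MA \<Omega> p \<phi>"
| conj: "\<lbrakk>knows MA \<Omega> p \<phi>; knows MA \<Omega> p \<psi>\<rbrakk> \<Longrightarrow> knows MA \<Omega> p (And \<phi> \<psi>)"
| detach: "knows MA \<Omega> p (And \<phi> (Imp \<phi> \<psi>)) \<Longrightarrow> knows MA \<Omega> p \<psi>"
| trust: "\<lbrakk>knows MA \<Omega> (p @ [A, B]) \<phi>; compatible MA {A, B}\<rbrakk> \<Longrightarrow> knows MA \<Omega> (p @ [A]) \<phi>"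
| stored: "\<lbrakk>knows MA \<Omega> p (Is [A \<mapsto> a]); A \<in> agents MA\<rbrakk> \<Longrightarrow> knows MA \<Omega> (p @ [A]) (Is [A \<mapsto> a])"
| part: "\<lbrakk>knows MA \<Omega> p (Is v); u \<subseteq>\<^sub>m v; dom u \<noteq> {}\<rbrakk> \<Longrightarrow> knows MA \<Omega> p (Is u)"
| merge: "\<lbrakk>knows MA \<Omega> p (Is u); knows MA \<Omega> p (Is v); u \<subseteq>\<^sub>m u ++ v; usable MA (Is (u ++ v))\<rbrakk>
    \<Longrightarrow> knows MA \<Omega> p (Is (u ++ v))"
| exclude: "\<lbrakk>knows MA \<Omega> p (Is u); valid_asg MA v; u A = Some a; v A = Some b; a \<noteq> b\<rbrakk>
    \<Longrightarrow> knows MA \<Omega> p (Is_not v)"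


section \<open>Paradoxes\<close>

definition non_contradictory :: "'b multi_agent_setup \<Rightarrow> fm set \<Rightarrow> bool" where
  "non_contradictory MA \<Omega> \<longleftrightarrow>
     \<not> (\<exists>A\<in>agents MA. \<exists>v. valid_asg MA v \<and> knows MA \<Omega> [A] (And (Is v) (Is_not v)))"

text \<open>
  Different outcome statements of \<open>MA\<close> refer to different runs.  The assumptions cannot
  hold simultaneously if they fail in some possible run.
\<close>

definition multi_agent_paradox :: "'b multi_agent_setup \<Rightarrow> bool" where
  "multi_agent_paradox MA \<longleftrightarrow> (\<exists>\<phi>\<in>outcome_statements MA. \<not> non_contradictory MA {\<phi>})"

definition next_agent :: "nat \<Rightarrow> nat \<Rightarrow> nat" where
  "next_agent n i = (if i = n then 1 else Suc i)"

definition cycle_setup :: "nat \<Rightarrow> 'b multi_agent_setup \<Rightarrow> bool" where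
  "cycle_setup n MA \<longleftrightarrow>
     quantum_setup MA \<and> num_agents MA = n \<and> (\<forall>i\<in>agents MA. outs MA i = {0, 1}) \<and>
     (\<forall>i\<in>agents MA. \<forall>k\<in>agents MA. i \<noteq> k \<longrightarrow>
        (compatible MA {i, k} \<longleftrightarrow> k = next_agent n i \<or> i = next_agent n k))"

text \<open>
  The chain \<open>x_i = a \<Rightarrow> x_(i+1) = v (i+1) \<Rightarrow> \<dots> \<Rightarrow> x_(i-1) = v (i-1) \<Rightarrow> x_i = b\<close>, each link of
  which is obtained by some agent without any outcome being post-selected.
\<close>

definition inference_chain ::
  "nat \<Rightarrow> 'b multi_agent_setup \<Rightarrow> nat \<Rightarrow> nat \<Rightarrow> (nat \<Rightarrow> nat) \<Rightarrow> nat \<Rightarrow> bool" where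
  "inference_chain n MA i a v b \<longleftrightarrow>
     (\<forall>k\<in>{1..n}. \<exists>A\<in>agents MA.
        knows MA {} [A]
          (Imp (Is [k \<mapsto> (v(i := a)) k])
               (Is [next_agent n k \<mapsto> (v(i := b)) (next_agent n k)])))"

definition post_selection_free_cycle_paradox :: "nat \<Rightarrow> 'b multi_agent_setup \<Rightarrow> bool" where
  "post_selection_free_cycle_paradox n MA \<longleftrightarrow>
     cycle_setup n MA \<and> multi_agent_paradox MA \<and>
     (\<exists>i\<in>{1..n}. \<exists>v v'.
        (\<forall>k\<in>{1..n} - {i}. v k \<in> {0, 1} \<and> v' k \<in> {0, 1} \<and> v k \<noteq> v' k) \<and>
        inference_chain n MA i 0 v 1 \<and> inference_chain n MA i 1 v' 0)"

end

theory Submission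
  imports Defs
begin

text \<open>
  In the Heisenberg picture every agent \<open>i\<close> has a single projective measurement \<open>Q i\<close>, the one of
  \<open>i\<close> conjugated by all the unitaries preceding it, whichever other agents are asked.  For \<open>j < k\<close>
  the joint probability of outcomes \<open>a\<close>, \<open>b\<close> of \<open>j\<close>, \<open>k\<close> vanishes only if \<open>Q k b (Q j a \<psi>) = 0\<close> for
  all \<open>\<psi>\<close> in the range of the initial state.  The two chains supply, for neighbours \<open>j\<close> and \<open>k\<close>, two
  such equations with opposite outcomes, and inserting \<open>\<Sum>a. Q j a = 1\<close> gives \<open>Q j a \<psi> = Q k b \<psi>\<close> for
  outcomes \<open>a\<close>, \<open>b\<close> linked by the chain.  Going once around the cycle yields \<open>Q i 0 \<psi> = Q i 1 \<psi>\<close>, so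
  both vanish by orthogonality and \<open>\<psi> = 0\<close>, although the initial state has trace 1.
\<close>

section \<open>Square-summable functions\<close>

lemma ell2_support: "f \<in> ell2 X \<Longrightarrow> x \<notin> X \<Longrightarrow> f x = 0"
  by (simp add: ell2_def)

lemma ell2_summable: "f \<in> ell2 X \<Longrightarrow> (\<lambda>x. (cmod (f x))\<^sup>2) summable_on X"
  by (simp add: ell2_def)

lemma inner2_summable:
  assumes "f \<in> ell2 X" "g \<in> ell2 X"
  shows "(\<lambda>x. cnj (f x) * g x) summable_on X"
  unfolding summable_on_iff_abs_summable_on_complex
proof (rule summable_on_comparison_test)
  show "(\<lambda>x. (cmod (f x))\<^sup>2 + (cmod (g x))\<^sup>2) summable_on X"
    by (intro summable_on_add ell2_summable assms)
next
  fix x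
  have "2 * (cmod (f x) * cmod (g x)) \<le> (cmod (f x))\<^sup>2 + (cmod (g x))\<^sup>2"
    using sum_squares_bound[of "cmod (f x)" "cmod (g x)"] by simp
  moreover have "0 \<le> cmod (f x) * cmod (g x)" by simp
  ultimately have "cmod (f x) * cmod (g x) \<le> (cmod (f x))\<^sup>2 + (cmod (g x))\<^sup>2" by linarith
  then show "cmod (cnj (f x) * g x) \<le> (cmod (f x))\<^sup>2 + (cmod (g x))\<^sup>2"
    by (simp add: norm_mult)
qed auto

lemma ell2_zero [simp]: "(\<lambda>x. 0) \<in> ell2 X"
  by (simp add: ell2_def)

lemma ell2_add:
  assumes "f \<in> ell2 X" "g \<in> ell2 X"
  shows "(\<lambda>x. f x + g x) \<in> ell2 X"
proof -
  have "(\<lambda>x. (cmod (f x + g x))\<^sup>2) summable_on X"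
  proof (rule summable_on_comparison_test)
    show "(\<lambda>x. 2 * (cmod (f x))\<^sup>2 + 2 * (cmod (g x))\<^sup>2) summable_on X"
      by (intro summable_on_add summable_on_cmult_right ell2_summable assms)
  next
    fix x
    have "(cmod (f x + g x))\<^sup>2 \<le> (cmod (f x) + cmod (g x))\<^sup>2"
      by (intro power_mono norm_triangle_ineq) auto
    also have "\<dots> \<le> 2 * (cmod (f x))\<^sup>2 + 2 * (cmod (g x))\<^sup>2"
      using sum_squares_bound[of "cmod (f x)" "cmod (g x)"] by (simp add: power2_sum)
    finally show "(cmod (f x + g x))\<^sup>2 \<le> 2 * (cmod (f x))\<^sup>2 + 2 * (cmod (g x))\<^sup>2" .
  qed auto
  then show ?thesis
    using assms by (auto simp: ell2_def)
qed

lemma ell2_scale: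
  assumes "f \<in> ell2 X"
  shows "(\<lambda>x. a * f x) \<in> ell2 X"
  using assms by (auto simp: ell2_def norm_mult power_mult_distrib intro: summable_on_cmult_right)

lemma ell2_lincomb:
  assumes "f \<in> ell2 X" "g \<in> ell2 X"
  shows "(\<lambda>x. a * f x + b * g x) \<in> ell2 X"
  by (intro ell2_add ell2_scale assms)

lemma ell2_sum:
  assumes "\<And>a. a \<in> A \<Longrightarrow> f a \<in> ell2 X"
  shows "(\<lambda>x. \<Sum>a\<in>A. f a x) \<in> ell2 X"
  using assms by (induction A rule: infinite_finite_induct) (auto intro!: ell2_add)

lemma ket_ell2: "x \<in> X \<Longrightarrow> ket x \<in> ell2 X"
proof -
  assume x: "x \<in> X"
  have "(\<lambda>y. (cmod (ket x y))\<^sup>2) summable_on X \<longleftrightarrow> (\<lambda>y. (cmod (ket x y))\<^sup>2) summable_on {x}"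
    by (rule summable_on_cong_neutral) (use x in \<open>auto simp: ket_def\<close>)
  then show ?thesis
    using x by (auto simp: ell2_def ket_def)
qed

lemma inner2_ket:
  assumes "x \<in> X"
  shows "inner2 X (ket x) g = g x"
proof -
  have "inner2 X (ket x) g = (\<Sum>\<^sub>\<infinity>y\<in>{x}. cnj (ket x y) * g y)"
    unfolding inner2_def
    by (rule infsum_cong_neutral) (use assms in \<open>auto simp: ket_def\<close>)
  then show ?thesis by (simp add: ket_def)
qed

lemma inner2_commute: "inner2 X g f = cnj (inner2 X f g)"
  by (simp add: inner2_def flip: infsum_cnj) (simp add: mult.commute)

lemma inner2_lincomb_right:
  assumes "f \<in> ell2 X" "g \<in> ell2 X" "h \<in> ell2 X"
  shows "inner2 X h (\<lambda>x. a * f x + b * g x) = a * inner2 X h f + b * inner2 X h g"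
proof -
  have "inner2 X h (\<lambda>x. a * f x + b * g x)
      = (\<Sum>\<^sub>\<infinity>x\<in>X. a * (cnj (h x) * f x) + b * (cnj (h x) * g x))"
    unfolding inner2_def by (simp add: algebra_simps)
  also have "\<dots> = a * inner2 X h f + b * inner2 X h g"
    unfolding inner2_def
    by (subst infsum_add)
      (auto intro!: summable_on_cmult_right inner2_summable assms simp: infsum_cmult_right')
  finally show ?thesis .
qed

lemma inner2_lincomb_left:
  assumes "f \<in> ell2 X" "g \<in> ell2 X" "h \<in> ell2 X"
  shows "inner2 X (\<lambda>x. a * f x + b * g x) h = cnj a * inner2 X f h + cnj b * inner2 X g h"
  using arg_cong[OF inner2_lincomb_right[OF assms, of a b], of cnj] by (simp flip: inner2_commute)

definition norm2 :: "'x set \<Rightarrow> 'x vec \<Rightarrow> real" where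
  "norm2 X f = (\<Sum>\<^sub>\<infinity>x\<in>X. (cmod (f x))\<^sup>2)"

lemma norm2_nonneg: "0 \<le> norm2 X f"
  by (simp add: norm2_def infsum_nonneg)

lemma inner2_self:
  assumes "f \<in> ell2 X"
  shows "inner2 X f f = of_real (norm2 X f)"
proof -
  have "((\<lambda>x. complex_of_real ((cmod (f x))\<^sup>2)) has_sum of_real (norm2 X f)) X"
    unfolding norm2_def by (intro has_sum_of_real has_sum_infsum ell2_summable assms)
  then show ?thesis
    unfolding inner2_def by (simp only: complex_norm_square mult.commute infsumI)
qed

lemma ell2_eq_zeroI:
  assumes "f \<in> ell2 X" "\<And>x. x \<in> X \<Longrightarrow> inner2 X (ket x) f = 0"
  shows "f = (\<lambda>x. 0)"
proof
  show "f x = 0" for x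
    using assms inner2_ket[of x X f] ell2_support[of f X x] by (cases "x \<in> X") auto
qed


section \<open>Operators\<close>

lemma linear_operator_closed: "linear_operator X A \<Longrightarrow> f \<in> ell2 X \<Longrightarrow> A f \<in> ell2 X"
  by (simp add: linear_operator_def)

lemma linear_operator_lincomb:
  "linear_operator X A \<Longrightarrow> f \<in> ell2 X \<Longrightarrow> g \<in> ell2 X \<Longrightarrow>
    A (\<lambda>x. a * f x + b * g x) = (\<lambda>x. a * A f x + b * A g x)"
  by (simp add: linear_operator_def)

lemma linear_operator_zero: "linear_operator X A \<Longrightarrow> A (\<lambda>x. 0) = (\<lambda>x. 0)"
  using linear_operator_lincomb[of X A "\<lambda>x. 0" "\<lambda>x. 0" 0 0] by simp

lemma linear_operator_add:
  "linear_operator X A \<Longrightarrow> f \<in> ell2 X \<Longrightarrow> g \<in> ell2 X \<Longrightarrow>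
    A (\<lambda>x. f x + g x) = (\<lambda>x. A f x + A g x)"
  using linear_operator_lincomb[of X A f g 1 1] by simp

lemma linear_operator_sum:
  assumes "linear_operator X A" "finite I" "\<And>a. a \<in> I \<Longrightarrow> f a \<in> ell2 X"
  shows "A (\<lambda>x. \<Sum>a\<in>I. f a x) = (\<lambda>x. \<Sum>a\<in>I. A (f a) x)"
  using assms(2,3)
proof (induction I rule: finite_induct)
  case empty
  then show ?case using linear_operator_zero[OF assms(1)] by simp
next
  case (insert b I)
  then have "A (\<lambda>x. f b x + (\<Sum>a\<in>I. f a x)) = (\<lambda>x. A (f b) x + A (\<lambda>x. \<Sum>a\<in>I. f a x) x)"
    by (intro linear_operator_add[OF assms(1)] ell2_sum) auto
  with insert show ?case by simp
qed

lemma linear_operator_compose: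
  "linear_operator X A \<Longrightarrow> linear_operator X B \<Longrightarrow> linear_operator X (A \<circ> B)"
  by (simp add: linear_operator_def)

lemma linear_operator_id: "linear_operator X id"
  by (simp add: linear_operator_def)

text \<open>Pythagoras: \<open>f - P f\<close> has squared norm
  \<open>norm2 X f - norm2 X (P f)\<close>, which is nonnegative. The bound is what later keeps the
  extension of \<open>P\<close> to a larger system inside the square-summable functions.\<close>

lemma projector_contractive:
  assumes P: "projector X P" and f: "f \<in> ell2 X"
  shows "norm2 X (P f) \<le> norm2 X f"
proof -
  have Pf: "P f \<in> ell2 X" using P f by (auto simp: projector_def linear_operator_def)
  have 1: "inner2 X (P f) (P f) = inner2 X f (P f)" "inner2 X (P f) f = inner2 X f (P f)"
    using P f Pf by (auto simp: projector_def)
  \<comment> \<open>The difference \<open>f - P f\<close>, spelt with coefficients so that the rules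
    for linear combinations apply.\<close>
  let ?g = "\<lambda>x. 1 * f x + (-1) * P f x"
  have g: "?g \<in> ell2 X" by (intro ell2_lincomb f Pf)
  have "inner2 X ?g ?g = inner2 X f f - inner2 X (P f) (P f)"
    unfolding inner2_lincomb_right[OF f Pf g] inner2_lincomb_left[OF f Pf f]
      inner2_lincomb_left[OF f Pf Pf] by (simp add: 1)
  then have "norm2 X ?g = norm2 X f - norm2 X (P f)"
    using inner2_self[OF g] inner2_self[OF f] inner2_self[OF Pf]
    by (metis of_real_diff of_real_eq_iff)
  with norm2_nonneg[of X ?g] show ?thesis by linarith
qed

section \<open>Unitary operators and their inverses\<close>

lemma unitary_operator_linear: "unitary_operator X U \<Longrightarrow> linear_operator X U"
  by (simp add: unitary_operator_def)

lemma unitary_operator_norm2: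
  assumes "unitary_operator X U" "f \<in> ell2 X"
  shows "norm2 X (U f) = norm2 X f"
proof -
  have "inner2 X (U f) (U f) = inner2 X f f"
    using assms by (simp add: unitary_operator_def)
  then show ?thesis
    using assms by (simp add: inner2_self linear_operator_closed unitary_operator_linear)
qed

lemma unitary_operator_inv:
  assumes "unitary_operator X U" "f \<in> ell2 X"
  shows "inv_into (ell2 X) U f \<in> ell2 X" "U (inv_into (ell2 X) U f) = f"
    "inv_into (ell2 X) U (U f) = f"
  using assms by (auto simp: unitary_operator_def bij_betw_def inv_into_into f_inv_into_f)

lemma unitary_operator_cancel:
  assumes "unitary_operator X U" "f \<in> ell2 X" "g \<in> ell2 X" "U f = U g"
  shows "f = g"
  using assms unitary_operator_inv(3) by metis

lemma unitary_operator_inverse: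
  assumes U: "unitary_operator X U"
  shows "unitary_operator X (inv_into (ell2 X) U)"
  unfolding unitary_operator_def linear_operator_def
proof (intro conjI ballI allI)
  let ?V = "inv_into (ell2 X) U"
  note inv = unitary_operator_inv[OF U]
  show "?V f \<in> ell2 X" if "f \<in> ell2 X" for f
    using inv that by blast
  show "bij_betw ?V (ell2 X) (ell2 X)"
    using U by (simp add: unitary_operator_def bij_betw_inv_into)
  \<comment> \<open>Both sides have the same image under the injective \<open>U\<close>.\<close>
  show "?V (\<lambda>x. a * f x + b * g x) = (\<lambda>x. a * ?V f x + b * ?V g x)"
    if "f \<in> ell2 X" "g \<in> ell2 X" for f g a b
    using that
    by (intro unitary_operator_cancel[OF U, of "?V (\<lambda>x. a * f x + b * g x)"])
      (simp_all add: inv ell2_lincomb linear_operator_lincomb[OF unitary_operator_linear[OF U]])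
  show "inner2 X (?V f) (?V g) = inner2 X f g" if "f \<in> ell2 X" "g \<in> ell2 X" for f g
    using that U inv by (metis unitary_operator_def)
qed

lemma unitary_operator_compose:
  "unitary_operator X A \<Longrightarrow> unitary_operator X B \<Longrightarrow> unitary_operator X (A \<circ> B)"
  unfolding unitary_operator_def
  by (auto intro: linear_operator_compose bij_betw_trans simp: linear_operator_closed)

lemma unitary_operator_id: "unitary_operator X id"
  by (auto simp: unitary_operator_def linear_operator_id)

lemma unitary_operator_eq_zero:
  assumes "unitary_operator X U" "f \<in> ell2 X" "U f = (\<lambda>x. 0)"
  shows "f = (\<lambda>x. 0)"
  by (rule unitary_operator_cancel[OF assms(1,2) ell2_zero])
    (simp add: assms linear_operator_zero[OF unitary_operator_linear[OF assms(1)]])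

text \<open>The adjoint as a relation: for unitaries and projectors it is explicit, and it composes
  in reverse order, so no general existence theorem for adjoints is invoked.\<close>

definition adjoint_pair :: "'x set \<Rightarrow> 'x oper \<Rightarrow> 'x oper \<Rightarrow> bool" where
  "adjoint_pair X B B' \<longleftrightarrow>
     (\<forall>f\<in>ell2 X. B f \<in> ell2 X) \<and> (\<forall>f\<in>ell2 X. B' f \<in> ell2 X) \<and>
     (\<forall>f\<in>ell2 X. \<forall>g\<in>ell2 X. inner2 X f (B g) = inner2 X (B' f) g)"

lemma adjoint_pair_id: "adjoint_pair X id id"
  by (simp add: adjoint_pair_def)

lemma adjoint_pair_compose:
  "adjoint_pair X A A' \<Longrightarrow> adjoint_pair X B B' \<Longrightarrow> adjoint_pair X (A \<circ> B) (B' \<circ> A')"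
  by (simp add: adjoint_pair_def)

lemma adjoint_pair_unitary: "unitary_operator X U \<Longrightarrow> adjoint_pair X U (inv_into (ell2 X) U)"
  unfolding adjoint_pair_def
  by (metis unitary_operator_def unitary_operator_inv(1,2) linear_operator_closed)

lemma adjoint_pair_projector: "projector X P \<Longrightarrow> adjoint_pair X P P"
  by (simp add: adjoint_pair_def projector_def linear_operator_closed)

text \<open>The degenerate case of Cauchy-Schwarz. As the form vanishes at \<open>f\<close>, its
  value at \<open>t f + g\<close> has no quadratic term in \<open>t\<close>; staying nonnegative for
  all complex \<open>t\<close> forces the mixed terms to vanish.\<close>

lemma positive_operator_null:
  assumes lin: "linear_operator X \<rho>"
    and pos: "\<And>f. f \<in> ell2 X \<Longrightarrow> inner2 X f (\<rho> f) \<in> \<real> \<and> 0 \<le> Re (inner2 X f (\<rho> f))"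
    and f: "f \<in> ell2 X" and g: "g \<in> ell2 X" and null: "inner2 X f (\<rho> f) = 0"
  shows "inner2 X g (\<rho> f) = 0" "inner2 X f (\<rho> g) = 0"
proof -
  define p where "p = inner2 X f (\<rho> g)"
  define q where "q = inner2 X g (\<rho> f)"
  define r where "r = inner2 X g (\<rho> g)"
  note cl = linear_operator_closed[OF lin]
  have expand: "inner2 X h (\<rho> h) = cnj t * p + t * q + r"
    if "h = (\<lambda>x. t * f x + 1 * g x)" for t h
    unfolding that linear_operator_lincomb[OF lin f g]
      inner2_lincomb_left[OF f g ell2_lincomb[OF cl[OF f] cl[OF g]]]
      inner2_lincomb_right[OF cl[OF f] cl[OF g] f] inner2_lincomb_right[OF cl[OF f] cl[OF g] g]
    using null by (simp add: p_def q_def r_def algebra_simps)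
  have val: "cnj t * p + t * q + r \<in> \<real> \<and> 0 \<le> Re (cnj t * p + t * q + r)" for t
    using pos[OF ell2_lincomb[OF f g, of t 1]] expand[OF refl, of t] by simp
  have "r \<in> \<real>" unfolding r_def using pos[OF g] by blast
  \<comment> \<open>Reality at \<open>t = 1\<close> makes the imaginary parts of \<open>p\<close>
    and \<open>q\<close> opposite; reality at \<open>t = \<i>\<close> makes the real parts
    equal.\<close>
  then have herm: "p = cnj q"
    using val[of 1] val[of \<i>] by (auto simp: complex_is_Real_iff complex_eq_iff)
  \<comment> \<open>Positivity at \<open>t = - s * cnj q\<close>, for arbitrarily large \<open>s\<close>, forces \<open>q = 0\<close>.\<close>
  have "(cmod q)\<^sup>2 * (2 * s) \<le> Re r" for s :: real
  proof -
    have "cnj (- of_real s * cnj q) * p + (- of_real s * cnj q) * q + r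
        = of_real (- (2 * s) * (cmod q)\<^sup>2) + r"
      unfolding herm of_real_mult complex_norm_square by (simp add: algebra_simps)
    then have "Re (cnj (- of_real s * cnj q) * p + (- of_real s * cnj q) * q + r)
        = - (2 * s) * (cmod q)\<^sup>2 + Re r"
      by (metis Re_complex_of_real plus_complex.sel(1))
    then show ?thesis using val[of "- of_real s * cnj q"] by (simp add: algebra_simps)
  qed
  \<comment> \<open>If \<open>q \<noteq> 0\<close>, this \<open>s\<close> turns the left side into
    \<open>Re r + 1\<close>.\<close>
  from this[of "(Re r + 1) / (2 * (cmod q)\<^sup>2)"] have "q = 0"
    by (cases "q = 0") (auto simp: field_simps)
  with herm show "inner2 X g (\<rho> f) = 0" "inner2 X f (\<rho> g) = 0"
    by (simp_all add: p_def q_def)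
qed

section \<open>Consequences of the value of a trace\<close>

lemma trace_pos_zero_diagonal:
  assumes "trace_pos X A = 0" "x \<in> X"
  shows "Re (A (ket x) x) \<le> 0"
proof -
  have "ennreal (Re (A (ket x) x)) = 0"
  proof (rule antisym)
    have "ennreal (Re (A (ket x) x)) = (\<Sum>\<^sub>\<infinity>x\<in>{x}. ennreal (Re (A (ket x) x)))" by simp
    also have "\<dots> \<le> trace_pos X A"
      unfolding trace_pos_def by (rule infsum_mono_neutral) (use assms in \<open>auto intro: nonneg_summable_on_complete\<close>)
    finally show "ennreal (Re (A (ket x) x)) \<le> 0" using assms by simp
  qed simp
  \<comment> \<open>\<open>ennreal\<close> sends negative reals to 0, so only an upper bound is
    obtained; positivity has to supply the other half.\<close>
  then show ?thesis by (simp add: ennreal_eq_0_iff)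
qed

text \<open>
  Testing the vanishing diagonal on \<open>ket x\<close> shows that \<open>\<rho>\<close> annihilates \<open>B' (ket x)\<close>; moving \<open>B\<close>
  and \<open>\<rho>\<close> across the inner product then makes all coordinates of \<open>B (\<rho> f)\<close> vanish.
\<close>

lemma trace_pos_zero_annihilates:
  assumes \<rho>: "density_operator X \<rho>" and B: "adjoint_pair X B B'"
    and tr: "trace_pos X (B \<circ> \<rho> \<circ> B') = 0" and f: "f \<in> ell2 X"
  shows "B (\<rho> f) = (\<lambda>x. 0)"
proof (rule ell2_eq_zeroI)
  have lin: "linear_operator X \<rho>"
    and pos: "\<And>f. f \<in> ell2 X \<Longrightarrow> inner2 X f (\<rho> f) \<in> \<real> \<and> 0 \<le> Re (inner2 X f (\<rho> f))"
    using \<rho> by (auto simp: density_operator_def)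
  have cl: "\<And>f. f \<in> ell2 X \<Longrightarrow> \<rho> f \<in> ell2 X" using linear_operator_closed[OF lin] .
  show "B (\<rho> f) \<in> ell2 X" using B cl[OF f] by (simp add: adjoint_pair_def)
  fix x assume x: "x \<in> X"
  have k: "ket x \<in> ell2 X" and Bk: "B' (ket x) \<in> ell2 X"
    using ket_ell2[OF x] B by (auto simp: adjoint_pair_def)
  have "inner2 X (B' (ket x)) (\<rho> (B' (ket x))) = inner2 X (ket x) (B (\<rho> (B' (ket x))))"
    using B k Bk cl by (simp add: adjoint_pair_def)
  also have "\<dots> = (B \<circ> \<rho> \<circ> B') (ket x) x" by (simp add: inner2_ket[OF x])
  finally have "Re (inner2 X (B' (ket x)) (\<rho> (B' (ket x)))) \<le> 0"
    using trace_pos_zero_diagonal[OF tr x] by simp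
  then have "inner2 X (B' (ket x)) (\<rho> (B' (ket x))) = 0"
    using pos[OF Bk] by (auto simp: complex_is_Real_iff complex_eq_iff)
  then have "inner2 X (B' (ket x)) (\<rho> f) = 0"
    by (intro positive_operator_null(2)[OF lin _ Bk f] pos)
  then show "inner2 X (ket x) (B (\<rho> f)) = 0"
    using B k cl[OF f] by (simp add: adjoint_pair_def)
qed

text \<open>Supplies the vector on which the final contradiction rests: an operator that is zero on
  all of \<open>ell2 X\<close> has zero diagonal, hence trace 0 and not 1.\<close>

lemma density_operator_nonzero:
  assumes "density_operator X \<rho>"
  obtains f where "f \<in> ell2 X" "\<rho> f \<noteq> (\<lambda>x. 0)"
proof -
  have "trace_pos X \<rho> = 0" if "\<And>f. f \<in> ell2 X \<Longrightarrow> \<rho> f = (\<lambda>x. 0)"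
    unfolding trace_pos_def by (rule infsum_0) (simp add: that ket_ell2)
  moreover have "trace_pos X \<rho> = 1" using assms by (simp add: density_operator_def)
  ultimately show ?thesis using that by fastforce
qed

text \<open>Passage to the Heisenberg picture. The inverse of a unitary is also its adjoint, so
  conjugation keeps idempotence and symmetry, and linearity of the inverse keeps orthogonality and
  completeness.\<close>

lemma projective_measurement_conj:
  assumes U: "unitary_operator X U" and P: "projective_measurement X Out P"
  shows "projective_measurement X Out (\<lambda>a. inv_into (ell2 X) U \<circ> P a \<circ> U)"
proof -
  let ?V = "inv_into (ell2 X) U"
  note inv = unitary_operator_inv[OF U]
  note Ul = unitary_operator_linear[OF U] and Vl = unitary_operator_linear[OF unitary_operator_inverse[OF U]]
  have Ucl: "f \<in> ell2 X \<Longrightarrow> U f \<in> ell2 X" for f using linear_operator_closed[OF Ul] .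
  have pr: "projector X (P a)" if "a \<in> Out" for a
    using P that by (simp add: projective_measurement_def)
  have Pcl: "f \<in> ell2 X \<Longrightarrow> P a f \<in> ell2 X" if "a \<in> Out" for a f
    using pr[OF that] by (simp add: projector_def linear_operator_closed)
  show ?thesis
    unfolding projective_measurement_def
  proof (intro conjI ballI impI)
    show "finite Out" using P by (simp add: projective_measurement_def)
    show "projector X (?V \<circ> P a \<circ> U)" if a: "a \<in> Out" for a
      unfolding projector_def
    proof (intro conjI ballI)
      show "linear_operator X (?V \<circ> P a \<circ> U)"
        using pr[OF a] by (intro linear_operator_compose Ul Vl) (simp add: projector_def)
      show "(?V \<circ> P a \<circ> U) ((?V \<circ> P a \<circ> U) f) = (?V \<circ> P a \<circ> U) f" if "f \<in> ell2 X" for f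
        using that pr[OF a] by (simp add: inv Pcl[OF a] Ucl projector_def)
      show "inner2 X ((?V \<circ> P a \<circ> U) f) g = inner2 X f ((?V \<circ> P a \<circ> U) g)"
        if f: "f \<in> ell2 X" and g: "g \<in> ell2 X" for f g
      proof -
        have iso: "inner2 X (U f) (U g) = inner2 X f g" if "f \<in> ell2 X" "g \<in> ell2 X" for f g
          using U that by (simp add: unitary_operator_def)
        have "inner2 X (?V (P a (U f))) g = inner2 X (P a (U f)) (U g)"
          using iso[of "?V (P a (U f))" g] f g by (simp add: inv Pcl[OF a] Ucl)
        also have "\<dots> = inner2 X (U f) (P a (U g))"
          using pr[OF a] f g by (simp add: projector_def Ucl)
        also have "\<dots> = inner2 X f (?V (P a (U g)))"
          using iso[of f "?V (P a (U g))"] f g by (simp add: inv Pcl[OF a] Ucl)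
        finally show ?thesis by simp
      qed
    qed
    show "(?V \<circ> P a \<circ> U) ((?V \<circ> P b \<circ> U) f) = (\<lambda>x. 0)"
      if "a \<in> Out" "b \<in> Out" "a \<noteq> b" "f \<in> ell2 X" for a b f
      using that P by (simp add: inv Pcl Ucl projective_measurement_def linear_operator_zero[OF Vl])
    show "(\<lambda>x. \<Sum>a\<in>Out. (?V \<circ> P a \<circ> U) f x) = f" if f: "f \<in> ell2 X" for f
    proof -
      have "(\<lambda>x. \<Sum>a\<in>Out. ?V (P a (U f)) x) = ?V (\<lambda>x. \<Sum>a\<in>Out. P a (U f) x)"
        by (rule linear_operator_sum[OF Vl, symmetric])
          (use P f Pcl Ucl in \<open>auto simp: projective_measurement_def\<close>)
      also have "\<dots> = f"
        using P f Ucl by (simp add: projective_measurement_def inv)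
      finally show ?thesis by simp
    qed
  qed
qed

section \<open>Measurements and chronological products\<close>

lemma projective_measurement_projector:
  "projective_measurement X Out P \<Longrightarrow> a \<in> Out \<Longrightarrow> projector X (P a)"
  by (simp add: projective_measurement_def)

lemma projective_measurement_linear:
  "projective_measurement X Out P \<Longrightarrow> a \<in> Out \<Longrightarrow> linear_operator X (P a)"
  by (simp add: projective_measurement_def projector_def)

text \<open>The chronological product: the head of the list acts first, so appending a later step
  composes it on the left.\<close>

definition compose_all :: "('i \<Rightarrow> 'a \<Rightarrow> 'a) \<Rightarrow> 'i list \<Rightarrow> 'a \<Rightarrow> 'a" where
  "compose_all F xs = fold (\<lambda>i. (\<circ>) (F i)) xs id"

lemma compose_all_Nil [simp]: "compose_all F [] = id"
  by (simp add: compose_all_def)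

lemma compose_all_snoc: "compose_all F (xs @ [i]) = F i \<circ> compose_all F xs"
  by (simp add: compose_all_def)

lemma compose_all_append: "compose_all F (xs @ ys) = compose_all F ys \<circ> compose_all F xs"
  by (induction ys rule: rev_induct) (simp_all add: compose_all_snoc o_assoc flip: append_assoc)

lemma compose_all_cong:
  "(\<And>i. i \<in> set xs \<Longrightarrow> F i = G i) \<Longrightarrow> compose_all F xs = compose_all G xs"
  by (induction xs rule: rev_induct) (simp_all add: compose_all_snoc)

text \<open>Insert both resolutions of the identity. In \<open>f = Q a f + Q a' f\<close> the
  operator \<open>R b\<close> kills the second summand, so \<open>R b f = R b (Q a f)\<close>; in
  \<open>Q a f = R b (Q a f) + R b' (Q a f)\<close> the second summand vanishes as well.\<close>

lemma binary_measurements_agree: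
  assumes Q: "projective_measurement X {a, a'} Q" "a \<noteq> a'"
    and R: "projective_measurement X {b, b'} R" "b \<noteq> b'"
    and f: "f \<in> ell2 X"
    and null: "R b' (Q a f) = (\<lambda>x. 0)" "R b (Q a' f) = (\<lambda>x. 0)"
  shows "R b f = Q a f"
proof -
  note lin = projective_measurement_linear[OF Q(1)] projective_measurement_linear[OF R(1)]
  have Qf: "Q a f \<in> ell2 X" "Q a' f \<in> ell2 X"
    using lin f by (auto intro: linear_operator_closed)
  have "f = (\<lambda>x. Q a f x + Q a' f x)"
    using Q f by (simp add: projective_measurement_def)
  then have "R b f = R b (\<lambda>x. Q a f x + Q a' f x)" by simp
  also have "\<dots> = R b (Q a f)"
    using Qf by (subst linear_operator_add[OF lin(2)]) (simp_all add: null)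
  also have "\<dots> = (\<lambda>x. R b (Q a f) x + R b' (Q a f) x)"
    by (simp add: null)
  also have "\<dots> = Q a f"
    using R Qf by (simp add: projective_measurement_def)
  finally show ?thesis .
qed


section \<open>Appending identities\<close>

text \<open>The slice of \<open>f\<close> through \<open>y\<close> in the directions
  \<open>R\<close>. It depends only on the coordinates of \<open>y\<close> outside \<open>R\<close>,
  so the index may be a point of the whole product or just of the remaining coordinates.\<close>

definition fibre ::
  "(sys \<Rightarrow> 'b set) \<Rightarrow> sys set \<Rightarrow> (sys \<Rightarrow> 'b) vec \<Rightarrow> (sys \<Rightarrow> 'b) \<Rightarrow> (sys \<Rightarrow> 'b) vec" where
  "fibre bs R f y = (\<lambda>u. if u \<in> PiE R bs then f (override_on y u R) else 0)"

lemma append_id_fibre: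
  "append_id bs W R A f x = (if x \<in> PiE W bs then A (fibre bs R f x) (restrict x R) else 0)"
  by (simp add: append_id_def fibre_def)

lemma override_on_PiE:
  assumes "R \<subseteq> W" "y \<in> PiE (W - R) bs" "u \<in> PiE R bs"
  shows "override_on y u R \<in> PiE W bs" "restrict (override_on y u R) R = u"
    "restrict (override_on y u R) (W - R) = y"
proof -
  \<comment> \<open>Members of \<open>PiE\<close> take the value \<open>undefined\<close> off their
    domain; this is what makes the two restrictions equal to \<open>u\<close> and \<open>y\<close>
    as functions.\<close>
  have y: "y i = undefined" if "i \<notin> W - R" for i using assms(2) that by (rule PiE_arb)
  have u: "u i = undefined" if "i \<notin> R" for i using assms(3) that by (rule PiE_arb)
  show "override_on y u R \<in> PiE W bs"
  proof (rule PiE_I)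
    show "override_on y u R i \<in> bs i" if "i \<in> W" for i
      using that PiE_mem[OF assms(2), of i] PiE_mem[OF assms(3), of i]
      by (cases "i \<in> R") (simp_all add: override_on_def)
    show "override_on y u R i = undefined" if "i \<notin> W" for i
      using that assms(1) y[of i] by (auto simp: override_on_def)
  qed
  show "restrict (override_on y u R) R = u"
    using u by (simp add: fun_eq_iff override_on_def)
  show "restrict (override_on y u R) (W - R) = y"
    using y by (simp add: fun_eq_iff override_on_def)
qed

lemma override_on_restrict:
  assumes "R \<subseteq> W" "x \<in> PiE W bs"
  shows "override_on (restrict x (W - R)) u R = override_on x u R"
    and "override_on x (restrict x R) R = x"
proof -
  have x: "x i = undefined" if "i \<notin> W" for i using assms(2) that by (rule PiE_arb)
  show "override_on (restrict x (W - R)) u R = override_on x u R"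
    using x by (simp add: fun_eq_iff override_on_def)
  show "override_on x (restrict x R) R = x"
    by (simp add: fun_eq_iff override_on_def)
qed

lemma restrict_PiE_subset: "R \<subseteq> W \<Longrightarrow> x \<in> PiE W bs \<Longrightarrow> restrict x R \<in> PiE R bs"
  by (auto simp: PiE_iff)

lemma fibre_restrict:
  assumes "R \<subseteq> W" "x \<in> PiE W bs"
  shows "fibre bs R f (restrict x (W - R)) = fibre bs R f x"
  by (simp add: fibre_def override_on_restrict[OF assms] cong: if_cong)

lemma fibre_override_on: "fibre bs R f (override_on y u R) = fibre bs R f y"
proof -
  have "override_on (override_on y u R) v R = override_on y v R" for v
    by (auto simp: override_on_def)
  then show ?thesis by (simp add: fibre_def cong: if_cong)
qed

text \<open>The tensor product at the level of bases: sums over the basis of \<open>W\<close> become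
  double sums over the bases of \<open>W - R\<close> and \<open>R\<close>.\<close>

lemma bij_betw_override_on:
  assumes "R \<subseteq> W"
  shows "bij_betw (\<lambda>(y, u). override_on y u R) (PiE (W - R) bs \<times> PiE R bs) (PiE W bs)"
proof (rule bij_betwI[where g = "\<lambda>x. (restrict x (W - R), restrict x R)"])
  show "(\<lambda>(y, u). override_on y u R) \<in> PiE (W - R) bs \<times> PiE R bs \<rightarrow> PiE W bs"
  proof
    fix p assume "p \<in> PiE (W - R) bs \<times> PiE R bs"
    then show "(case p of (y, u) \<Rightarrow> override_on y u R) \<in> PiE W bs"
      using override_on_PiE(1)[OF assms, of "fst p" bs "snd p"] by (simp add: mem_Times_iff split_def)
  qed
  show "(\<lambda>x. (restrict x (W - R), restrict x R)) \<in> PiE W bs \<rightarrow> PiE (W - R) bs \<times> PiE R bs"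
    by (rule Pi_I) (simp only: mem_Times_iff fst_conv snd_conv restrict_PiE_subset[OF Diff_subset]
        restrict_PiE_subset[OF assms])
  show "(restrict (case p of (y, u) \<Rightarrow> override_on y u R) (W - R),
      restrict (case p of (y, u) \<Rightarrow> override_on y u R) R) = p"
    if "p \<in> PiE (W - R) bs \<times> PiE R bs" for p
    using that override_on_PiE(2,3)[OF assms, of "fst p" bs "snd p"]
    by (simp add: mem_Times_iff split_def)
  show "(case (restrict x (W - R), restrict x R) of (y, u) \<Rightarrow> override_on y u R) = x"
    if "x \<in> PiE W bs" for x
    using that by (simp add: override_on_restrict[OF assms])
qed

section \<open>Transfer from a subsystem to the whole, slice by slice\<close>

context
  fixes bs :: "sys \<Rightarrow> 'b set" and W R :: "sys set"
  assumes RW: "R \<subseteq> W"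
begin

text \<open>The value of a vector at \<open>x\<close> is read off its slice through
  \<open>x\<close>. Operator identities on \<open>W\<close> are thereby reduced to identities on
  \<open>R\<close>.\<close>

lemma fibre_eqI:
  assumes "f \<in> ell2 (PiE W bs)" "g \<in> ell2 (PiE W bs)"
    and "\<And>y. y \<in> PiE (W - R) bs \<Longrightarrow> fibre bs R f y = fibre bs R g y"
  shows "f = g"
proof
  fix x
  show "f x = g x"
  proof (cases "x \<in> PiE W bs")
    case True
    have "fibre bs R f x = fibre bs R g x"
      using assms(3)[OF restrict_PiE_subset[OF Diff_subset True]]
      unfolding fibre_restrict[OF RW True] .
    moreover have "fibre bs R h x (restrict x R) = h x" for h
      unfolding fibre_def override_on_restrict(2)[OF RW True]
      using restrict_PiE_subset[OF RW True] by (rule if_P)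
    ultimately show ?thesis by (metis (no_types))
  qed (use assms in \<open>simp add: ell2_support\<close>)
qed

lemma summable_on_fibres:
  "(\<lambda>x. h x) summable_on PiE W bs \<longleftrightarrow>
    (\<lambda>(y, u). h (override_on y u R)) summable_on PiE (W - R) bs \<times> PiE R bs"
  using summable_on_reindex_bij_betw[OF bij_betw_override_on[OF RW, of bs], of h]
  by (simp add: case_prod_beta')

lemma fibre_ell2:
  assumes f: "f \<in> ell2 (PiE W bs)" and y: "y \<in> PiE (W - R) bs"
  shows "fibre bs R f y \<in> ell2 (PiE R bs)"
proof -
  have "(\<lambda>u. (cmod (f (override_on y u R)))\<^sup>2) summable_on PiE R bs"
    using summable_on_SigmaD1[OF ell2_summable[OF f, unfolded summable_on_fibres] y] by simp
  then have "(\<lambda>u. (cmod (fibre bs R f y u))\<^sup>2) summable_on PiE R bs"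
    by (rule summable_on_cong[THEN iffD1, rotated]) (simp add: fibre_def)
  then show ?thesis by (simp add: ell2_def fibre_def)
qed

lemma norm2_fibre_summable:
  assumes f: "f \<in> ell2 (PiE W bs)"
  shows "(\<lambda>y. norm2 (PiE R bs) (fibre bs R f y)) summable_on PiE (W - R) bs"
proof -
  have "(\<lambda>y. \<Sum>\<^sub>\<infinity>u\<in>PiE R bs. (cmod (f (override_on y u R)))\<^sup>2) summable_on PiE (W - R) bs"
    using ell2_summable[OF f, unfolded summable_on_fibres]
    by (intro summable_on_Sigma_banach) simp
  then show ?thesis
    by (rule summable_on_cong[THEN iffD1, rotated]) (simp add: norm2_def fibre_def cong: infsum_cong)
qed

text \<open>Tonelli: the terms are nonnegative, so summability within the slices and of the slice
  norms gives summability over the product. It reverses \<open>fibre_ell2\<close> and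
  \<open>norm2_fibre_summable\<close>.\<close>

lemma ell2_fibresI:
  assumes "\<And>x. x \<notin> PiE W bs \<Longrightarrow> f x = 0"
    and fib: "\<And>y. y \<in> PiE (W - R) bs \<Longrightarrow> fibre bs R f y \<in> ell2 (PiE R bs)"
    and sum: "(\<lambda>y. norm2 (PiE R bs) (fibre bs R f y)) summable_on PiE (W - R) bs"
  shows "f \<in> ell2 (PiE W bs)"
proof -
  have "(\<lambda>(y, u). (cmod (f (override_on y u R)))\<^sup>2) summable_on PiE (W - R) bs \<times> PiE R bs"
  proof (rule summable_on_SigmaI[OF _ sum])
    fix y assume y: "y \<in> PiE (W - R) bs"
    have "((\<lambda>u. (cmod (fibre bs R f y u))\<^sup>2) has_sum norm2 (PiE R bs) (fibre bs R f y)) (PiE R bs)"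
      unfolding norm2_def by (intro has_sum_infsum ell2_summable fib y)
    then show "((\<lambda>u. case (y, u) of (y, u) \<Rightarrow> (cmod (f (override_on y u R)))\<^sup>2) has_sum
        norm2 (PiE R bs) (fibre bs R f y)) (PiE R bs)"
      by (rule has_sum_cong[THEN iffD1, rotated]) (simp add: fibre_def)
  qed auto
  then show ?thesis
    using assms(1) by (simp add: ell2_def summable_on_fibres)
qed

text \<open>Fubini, justified by \<open>inner2_summable\<close>. Symmetry of projectors and isometry
  of unitaries can then be checked in each slice.\<close>

lemma inner2_fibres:
  assumes f: "f \<in> ell2 (PiE W bs)" and g: "g \<in> ell2 (PiE W bs)"
  shows "inner2 (PiE W bs) f g =
    (\<Sum>\<^sub>\<infinity>y\<in>PiE (W - R) bs. inner2 (PiE R bs) (fibre bs R f y) (fibre bs R g y))"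
proof -
  let ?h = "\<lambda>x. cnj (f x) * g x"
  have "inner2 (PiE W bs) f g =
      (\<Sum>\<^sub>\<infinity>p\<in>PiE (W - R) bs \<times> PiE R bs. ?h ((\<lambda>(y, u). override_on y u R) p))"
    unfolding inner2_def
    by (rule infsum_reindex_bij_betw[OF bij_betw_override_on[OF RW], symmetric])
  also have "\<dots> = (\<Sum>\<^sub>\<infinity>(y, u)\<in>PiE (W - R) bs \<times> PiE R bs. ?h (override_on y u R))"
    by (simp add: case_prod_beta')
  also have "\<dots> = (\<Sum>\<^sub>\<infinity>y\<in>PiE (W - R) bs. \<Sum>\<^sub>\<infinity>u\<in>PiE R bs. ?h (override_on y u R))"
    by (rule infsum_Sigma'_banach[symmetric])
      (use inner2_summable[OF f g, unfolded summable_on_fibres] in simp)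
  also have "\<dots> = (\<Sum>\<^sub>\<infinity>y\<in>PiE (W - R) bs. inner2 (PiE R bs) (fibre bs R f y) (fibre bs R g y))"
    by (intro infsum_cong) (simp add: inner2_def fibre_def cong: infsum_cong)
  finally show ?thesis .
qed

text \<open>The extended operator acts on every slice separately, by \<open>A\<close> itself,
  because all points of a slice share that slice.\<close>

lemma fibre_append_id:
  assumes A: "\<And>f. f \<in> ell2 (PiE R bs) \<Longrightarrow> A f \<in> ell2 (PiE R bs)"
    and f: "f \<in> ell2 (PiE W bs)" and y: "y \<in> PiE (W - R) bs"
  shows "fibre bs R (append_id bs W R A f) y = A (fibre bs R f y)"
proof
  fix u
  show "fibre bs R (append_id bs W R A f) y u = A (fibre bs R f y) u"
  proof (cases "u \<in> PiE R bs")
    case True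
    note ov = override_on_PiE[OF RW y True]
    have "fibre bs R (append_id bs W R A f) y u = append_id bs W R A f (override_on y u R)"
      using True by (simp add: fibre_def)
    also have "\<dots> = A (fibre bs R f y) u"
      by (simp add: append_id_fibre ov fibre_override_on)
    finally show ?thesis .
  next
    \<comment> \<open>Off the basis of \<open>R\<close> both sides are 0: the slice by definition,
      the image because \<open>A\<close> stays in \<open>ell2\<close>.\<close>
    case False
    then show ?thesis
      using ell2_support[OF A[OF fibre_ell2[OF f y]]] by (simp add: fibre_def)
  qed
qed

lemma fibre_lincomb:
  "fibre bs R (\<lambda>x. a * f x + b * g x) y = (\<lambda>u. a * fibre bs R f y u + b * fibre bs R g y u)"
  by (auto simp: fibre_def)

lemma fibre_zero: "fibre bs R (\<lambda>x. 0) y = (\<lambda>u. 0)"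
  by (auto simp: fibre_def)

lemma fibre_sum: "fibre bs R (\<lambda>x. \<Sum>a\<in>I. f a x) y = (\<lambda>u. \<Sum>a\<in>I. fibre bs R (f a) y u)"
  by (auto simp: fibre_def)

text \<open>Square-summability of the result is where contractivity of the operator is needed.\<close>

lemma linear_operator_append_id:
  assumes lin: "linear_operator (PiE R bs) A"
    and contr: "\<And>f. f \<in> ell2 (PiE R bs) \<Longrightarrow> norm2 (PiE R bs) (A f) \<le> norm2 (PiE R bs) f"
  shows "linear_operator (PiE W bs) (append_id bs W R A)"
  unfolding linear_operator_def
proof (intro conjI ballI allI)
  note cl = linear_operator_closed[OF lin]
  show closed: "append_id bs W R A f \<in> ell2 (PiE W bs)" if f: "f \<in> ell2 (PiE W bs)" for f
  proof (rule ell2_fibresI)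
    show "append_id bs W R A f x = 0" if "x \<notin> PiE W bs" for x
      using that by (simp add: append_id_fibre)
    show "fibre bs R (append_id bs W R A f) y \<in> ell2 (PiE R bs)" if "y \<in> PiE (W - R) bs" for y
      by (simp add: fibre_append_id[OF cl f that] cl fibre_ell2[OF f that])
    show "(\<lambda>y. norm2 (PiE R bs) (fibre bs R (append_id bs W R A f) y)) summable_on PiE (W - R) bs"
    proof (rule summable_on_comparison_test[OF norm2_fibre_summable[OF f]])
      fix y assume y: "y \<in> PiE (W - R) bs"
      show "norm2 (PiE R bs) (fibre bs R (append_id bs W R A f) y) \<le> norm2 (PiE R bs) (fibre bs R f y)"
        by (simp add: fibre_append_id[OF cl f y] contr fibre_ell2[OF f y])
    qed (rule norm2_nonneg)
  qed
  show "append_id bs W R A (\<lambda>x. a * f x + b * g x) =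
      (\<lambda>x. a * append_id bs W R A f x + b * append_id bs W R A g x)"
    if f: "f \<in> ell2 (PiE W bs)" and g: "g \<in> ell2 (PiE W bs)" for f g a b
    by (rule fibre_eqI)
      (simp_all add: closed ell2_lincomb f g fibre_append_id[OF cl] fibre_lincomb fibre_ell2
        linear_operator_lincomb[OF lin])
qed

lemma projector_append_id:
  assumes P: "projector (PiE R bs) P"
  shows "projector (PiE W bs) (append_id bs W R P)"
  unfolding projector_def
proof (intro conjI ballI)
  have lin: "linear_operator (PiE R bs) P" using P by (simp add: projector_def)
  note cl = linear_operator_closed[OF lin]
  show linW: "linear_operator (PiE W bs) (append_id bs W R P)"
    by (intro linear_operator_append_id lin projector_contractive[OF P])
  note clW = linear_operator_closed[OF linW]
  show "append_id bs W R P (append_id bs W R P f) = append_id bs W R P f"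
    if f: "f \<in> ell2 (PiE W bs)" for f
    using P by (intro fibre_eqI[of "append_id bs W R P (append_id bs W R P f)"])
      (simp_all add: clW f fibre_append_id[OF cl] fibre_ell2 projector_def)
  show "inner2 (PiE W bs) (append_id bs W R P f) g = inner2 (PiE W bs) f (append_id bs W R P g)"
    if f: "f \<in> ell2 (PiE W bs)" and g: "g \<in> ell2 (PiE W bs)" for f g
    using P by (simp add: inner2_fibres clW f g fibre_append_id[OF cl] fibre_ell2 projector_def
        cong: infsum_cong)
qed

lemma projective_measurement_append_id:
  assumes P: "projective_measurement (PiE R bs) Out P"
  shows "projective_measurement (PiE W bs) Out (\<lambda>a. append_id bs W R (P a))"
  unfolding projective_measurement_def
proof (intro conjI ballI impI)
  have pr: "projector (PiE R bs) (P a)" if "a \<in> Out" for a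
    using P that by (simp add: projective_measurement_def)
  have cl: "f \<in> ell2 (PiE R bs) \<Longrightarrow> P a f \<in> ell2 (PiE R bs)" if "a \<in> Out" for a f
    using pr[OF that] by (simp add: projector_def linear_operator_closed)
  show prW: "projector (PiE W bs) (append_id bs W R (P a))" if "a \<in> Out" for a
    using pr[OF that] by (rule projector_append_id)
  have clW: "f \<in> ell2 (PiE W bs) \<Longrightarrow> append_id bs W R (P a) f \<in> ell2 (PiE W bs)"
    if "a \<in> Out" for a f
    using prW[OF that] by (simp add: projector_def linear_operator_closed)
  show "finite Out" using P by (simp add: projective_measurement_def)
  show "append_id bs W R (P a) (append_id bs W R (P b) f) = (\<lambda>x. 0)"
    if "a \<in> Out" "b \<in> Out" "a \<noteq> b" "f \<in> ell2 (PiE W bs)" for a b f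
    using that P
    by (intro fibre_eqI[of "append_id bs W R (P a) (append_id bs W R (P b) f)"])
      (simp_all add: clW fibre_append_id[OF cl] fibre_ell2 fibre_zero
        projective_measurement_def)
  show "(\<lambda>x. \<Sum>a\<in>Out. append_id bs W R (P a) f x) = f" if f: "f \<in> ell2 (PiE W bs)" for f
    using P
    by (intro fibre_eqI[of _ f] ell2_sum)
      (simp_all add: clW f fibre_append_id[OF cl] fibre_ell2 fibre_sum
        projective_measurement_def)
qed

lemma unitary_operator_append_id:
  assumes U: "unitary_operator (PiE R bs) U"
  shows "unitary_operator (PiE W bs) (append_id bs W R U)"
proof -
  let ?V = "inv_into (ell2 (PiE R bs)) U"
  have lin: "linear_operator (PiE W bs) (append_id bs W R A)" if "unitary_operator (PiE R bs) A" for A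
    using that by (intro linear_operator_append_id)
      (simp_all add: unitary_operator_linear unitary_operator_norm2)
  have V: "unitary_operator (PiE R bs) ?V" by (rule unitary_operator_inverse[OF U])
  note Ucl = linear_operator_closed[OF unitary_operator_linear[OF U]]
  note Vcl = linear_operator_closed[OF unitary_operator_linear[OF V]]
  note clW = linear_operator_closed[OF lin[OF U]] linear_operator_closed[OF lin[OF V]]
  \<comment> \<open>Extending the inverse of \<open>U\<close> gives an explicit two-sided
    inverse.\<close>
  have "bij_betw (append_id bs W R U) (ell2 (PiE W bs)) (ell2 (PiE W bs))"
  proof (rule bij_betw_byWitness[where f' = "append_id bs W R ?V"])
    show "\<forall>f\<in>ell2 (PiE W bs). append_id bs W R ?V (append_id bs W R U f) = f"
      by (rule ballI, rule fibre_eqI)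
        (simp_all add: clW fibre_append_id[OF Ucl] fibre_append_id[OF Vcl] fibre_ell2
          unitary_operator_inv[OF U])
    show "\<forall>f\<in>ell2 (PiE W bs). append_id bs W R U (append_id bs W R ?V f) = f"
      by (rule ballI, rule fibre_eqI)
        (simp_all add: clW fibre_append_id[OF Ucl] fibre_append_id[OF Vcl] fibre_ell2
          unitary_operator_inv[OF U])
  qed (use clW in auto)
  moreover have "inner2 (PiE W bs) (append_id bs W R U f) (append_id bs W R U g) = inner2 (PiE W bs) f g"
    if f: "f \<in> ell2 (PiE W bs)" and g: "g \<in> ell2 (PiE W bs)" for f g
    using U by (simp add: inner2_fibres clW f g fibre_append_id[OF Ucl] fibre_ell2
        unitary_operator_def cong: infsum_cong)
  ultimately show ?thesis
    using lin[OF U] by (simp add: unitary_operator_def)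
qed

end


section \<open>Default predictions in the Heisenberg picture\<close>

definition evolution :: "'b multi_agent_setup \<Rightarrow> nat \<Rightarrow> (sys \<Rightarrow> 'b) oper" where
  "evolution MA i = append_id (bas MA) (all_systems MA) (target MA i \<union> {L i}) (evol MA i)"

definition outcome_projector :: "'b multi_agent_setup \<Rightarrow> nat \<Rightarrow> nat \<Rightarrow> (sys \<Rightarrow> 'b) oper" where
  "outcome_projector MA i a = append_id (bas MA) (all_systems MA) (target MA i) (meas MA i a)"

lemma unitary_evolution:
  assumes "quantum_setup MA" "i \<in> agents MA"
  shows "unitary_operator (total_space MA) (evolution MA i)"
  unfolding evolution_def total_space_def space_of_def
proof (rule unitary_operator_append_id)
  show "target MA i \<union> {L i} \<subseteq> all_systems MA"
    using assms by (auto simp: quantum_setup_def all_systems_def)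
  show "unitary_operator (PiE (target MA i \<union> {L i}) (bas MA)) (evol MA i)"
    using assms by (simp add: quantum_setup_def unitary_description_def space_of_def Let_def)
qed

lemma projective_outcome_projector:
  assumes "quantum_setup MA" "i \<in> agents MA"
  shows "projective_measurement (total_space MA) (outs MA i) (outcome_projector MA i)"
proof -
  have "target MA i \<subseteq> all_systems MA"
    and "projective_measurement (PiE (target MA i) (bas MA)) (outs MA i) (meas MA i)"
    using assms by (auto simp: quantum_setup_def space_of_def)
  then have "projective_measurement (PiE (all_systems MA) (bas MA)) (outs MA i)
      (\<lambda>a. append_id (bas MA) (all_systems MA) (target MA i) (meas MA i a))"
    by (rule projective_measurement_append_id)
  then show ?thesis
    by (simp add: outcome_projector_def[abs_def] total_space_def space_of_def)
qed

text \<open>The Kraus operator of one step: \<open>step\<close> is conjugation by it, with the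
  projection preceding the evolution.\<close>

definition kraus ::
  "'b multi_agent_setup \<Rightarrow> (nat \<Rightarrow> nat) \<Rightarrow> (nat \<Rightarrow> nat) \<Rightarrow> nat \<Rightarrow> (sys \<Rightarrow> 'b) oper" where
  "kraus MA s w i = evolution MA i \<circ> (if s i = 1 then outcome_projector MA i (w i) else id)"

text \<open>A whole run is conjugation by one operator and its adjoint, the form to which
  \<open>trace_pos_zero_annihilates\<close> applies. The adjoint \<open>B'\<close> is assembled from
  the projectors and inverse evolutions in reverse order and is the same for all states.\<close>

lemma fold_step:
  assumes qs: "quantum_setup MA" and "set xs \<subseteq> agents MA"
    and "\<And>i. i \<in> set xs \<Longrightarrow> s i = 1 \<Longrightarrow> w i \<in> outs MA i"
  shows "\<exists>B'. adjoint_pair (total_space MA) (compose_all (kraus MA s w) xs) B' \<and>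
    (\<forall>\<sigma>. fold (step MA s w) xs \<sigma> = compose_all (kraus MA s w) xs \<circ> \<sigma> \<circ> B')"
  using assms(2,3)
proof (induction xs rule: rev_induct)
  case Nil
  then show ?case by (intro exI[of _ id]) (simp add: adjoint_pair_def)
next
  case (snoc i xs)
  let ?B = "compose_all (kraus MA s w) xs"
  let ?P = "if s i = 1 then outcome_projector MA i (w i) else id"
  let ?V = "inv_into (ell2 (total_space MA)) (evolution MA i)"
  obtain B' where B': "adjoint_pair (total_space MA) ?B B'"
    and eq: "\<And>\<sigma>. fold (step MA s w) xs \<sigma> = ?B \<circ> \<sigma> \<circ> B'"
    using snoc.IH snoc.prems by fastforce
  have "adjoint_pair (total_space MA) ?P ?P"
    using snoc.prems qs
    by (auto intro!: adjoint_pair_id adjoint_pair_projector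
        projective_measurement_projector[OF projective_outcome_projector])
  moreover have "adjoint_pair (total_space MA) (evolution MA i) ?V"
    using snoc.prems qs by (simp add: adjoint_pair_unitary unitary_evolution)
  ultimately have "adjoint_pair (total_space MA) (evolution MA i \<circ> ?P \<circ> ?B) (B' \<circ> (?P \<circ> ?V))"
    by (intro adjoint_pair_compose B')
  moreover have "fold (step MA s w) (xs @ [i]) \<sigma> =
      (evolution MA i \<circ> ?P \<circ> ?B) \<circ> \<sigma> \<circ> (B' \<circ> (?P \<circ> ?V))" for \<sigma>
    by (simp add: eq step_def conj_unitary_def conj_projector_def o_assoc Let_def
        evolution_def outcome_projector_def)
  ultimately show ?case
    unfolding compose_all_snoc kraus_def[of MA s w i] by blast
qed

lemma unitary_compose_all_evolution:
  assumes "quantum_setup MA" "set xs \<subseteq> agents MA"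
  shows "unitary_operator (total_space MA) (compose_all (evolution MA) xs)"
  using assms(2)
  by (induction xs rule: rev_induct)
    (simp_all add: compose_all_snoc unitary_operator_id unitary_operator_compose
      unitary_evolution[OF assms(1)])

text \<open>The list stops before \<open>i\<close>: the projectors of \<open>i\<close> act on the
  state reached just before the evolution of \<open>i\<close> itself.\<close>

definition heisenberg :: "'b multi_agent_setup \<Rightarrow> nat \<Rightarrow> nat \<Rightarrow> (sys \<Rightarrow> 'b) oper" where
  "heisenberg MA i a =
     inv_into (ell2 (total_space MA)) (compose_all (evolution MA) [1..<i]) \<circ>
     outcome_projector MA i a \<circ> compose_all (evolution MA) [1..<i]"

lemma projective_heisenberg:
  assumes "quantum_setup MA" "i \<in> agents MA"
  shows "projective_measurement (total_space MA) (outs MA i) (heisenberg MA i)"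
  unfolding heisenberg_def[abs_def] using assms
  by (intro projective_measurement_conj unitary_compose_all_evolution projective_outcome_projector)
    (auto simp: agents_def)

text \<open>A vanishing trace means that the product of all Kraus operators kills
  \<open>init MA f\<close>. Apart from the projectors of \<open>j\<close> and \<open>k\<close> this
  product is unitary; the unitaries after \<open>k\<close> are cancelled, the earlier ones absorbed
  into \<open>heisenberg\<close>.\<close>

lemma joint_prob_zero:
  assumes qs: "quantum_setup MA" and j: "j \<in> agents MA" and k: "k \<in> agents MA" and less: "j < k"
    and out: "w j \<in> outs MA j" "w k \<in> outs MA k"
    and zero: "joint_prob MA (default_settings {j, k}) w = 0"
    and f: "f \<in> ell2 (total_space MA)"
  shows "heisenberg MA k (w k) (heisenberg MA j (w j) (init MA f)) = (\<lambda>x. 0)"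
proof -
  let ?X = "total_space MA" and ?s = "default_settings {j, k}" and ?N = "num_agents MA"
  let ?K = "compose_all (kraus MA ?s w)" and ?E = "compose_all (evolution MA)"
  let ?\<psi> = "init MA f"
  have split: "[1..<k] = [1..<j] @ [j] @ [Suc j..<k]"
    "[1..<Suc ?N] = [1..<j] @ [j] @ [Suc j..<k] @ [k] @ [Suc k..<Suc ?N]"
  proof -
    have *: "[1..<m] = [1..<i] @ [i] @ [Suc i..<m]" if "1 \<le> i" "i < m" for i m
      using that upt_add_eq_append[of 1 i "m - i"] by (simp add: upt_conv_Cons)
    show "[1..<k] = [1..<j] @ [j] @ [Suc j..<k]"
      using * j less by (simp add: agents_def)
    with *[of k "Suc ?N"]
    show "[1..<Suc ?N] = [1..<j] @ [j] @ [Suc j..<k] @ [k] @ [Suc k..<Suc ?N]"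
      using k by (simp add: agents_def del: upt_Suc)
  qed
  have sub: "set [1..<j] \<subseteq> agents MA" "set [Suc j..<k] \<subseteq> agents MA"
    "set [Suc k..<Suc ?N] \<subseteq> agents MA" "set [1..<k] \<subseteq> agents MA"
    "set [1..<Suc ?N] \<subseteq> agents MA"
    using j k less by (auto simp: agents_def simp del: upt_Suc)
  note E = unitary_compose_all_evolution[OF qs]
  note cl = linear_operator_closed[OF unitary_operator_linear]
  \<comment> \<open>All other agents have setting 0 and contribute their evolution only.\<close>
  have free: "?K xs = ?E xs" if "j \<notin> set xs" "k \<notin> set xs" for xs
    using that by (intro compose_all_cong) (auto simp: kraus_def default_settings_def)
  have dens: "density_operator ?X (init MA)" using qs by (simp add: quantum_setup_def)
  then have \<psi>: "?\<psi> \<in> ell2 ?X"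
    using f by (auto simp: density_operator_def linear_operator_closed)
  have Pcl: "outcome_projector MA i (w i) g \<in> ell2 ?X"
    if "i \<in> {j, k}" "g \<in> ell2 ?X" for i g
    using that out j k
    by (auto intro: linear_operator_closed
        projective_measurement_linear[OF projective_outcome_projector[OF qs]])
  have "trace_pos ?X (fold (step MA ?s w) [1..<Suc ?N] (init MA)) = 0"
    using zero by (simp add: joint_prob_def)
  moreover obtain B' where "adjoint_pair ?X (?K [1..<Suc ?N]) B'"
    "\<And>\<sigma>. fold (step MA ?s w) [1..<Suc ?N] \<sigma> = ?K [1..<Suc ?N] \<circ> \<sigma> \<circ> B'"
  proof -
    have "w i \<in> outs MA i" if "?s i = 1" for i
      using that out by (auto simp: default_settings_def split: if_splits)
    then show ?thesis using fold_step[OF qs sub(5), of ?s w] that by blast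
  qed
  ultimately have "?K [1..<Suc ?N] ?\<psi> = (\<lambda>x. 0)"
    using trace_pos_zero_annihilates[OF dens _ _ f] by metis
  \<comment> \<open>The unnormalised state just before \<open>k\<close> measures, in the branch
    where \<open>j\<close> has found \<open>w j\<close>.\<close>
  moreover define \<phi> where
    "\<phi> = ?E [Suc j..<k] (evolution MA j (outcome_projector MA j (w j) (?E [1..<j] ?\<psi>)))"
  ultimately have "?E [Suc k..<Suc ?N] (evolution MA k (outcome_projector MA k (w k) \<phi>)) = (\<lambda>x. 0)"
    using free[of "[1..<j]"] free[of "[Suc j..<k]"] free[of "[Suc k..<Suc ?N]"] less
    unfolding split(2) compose_all_append
    by (simp add: compose_all_snoc[of _ "[]", simplified] kraus_def
        default_settings_def[of "{j, k}"] del: upt_Suc)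
  moreover have \<phi>: "\<phi> \<in> ell2 ?X"
    unfolding \<phi>_def
    by (intro cl[OF E] cl[OF unitary_evolution[OF qs]] Pcl sub j \<psi>) simp
  \<comment> \<open>Everything that acts after the projector of \<open>k\<close> is unitary and
    hence has trivial kernel.\<close>
  ultimately have null: "outcome_projector MA k (w k) \<phi> = (\<lambda>x. 0)"
    using unitary_operator_eq_zero[OF E[OF sub(3)]] unitary_operator_eq_zero[OF unitary_evolution[OF qs k]]
      cl[OF unitary_evolution[OF qs k]] Pcl[of k \<phi>] by blast
  \<comment> \<open>Evolving to the time of \<open>k\<close> undoes the inverse evolution that ends
    \<open>heisenberg MA j (w j)\<close>.\<close>
  have "?E [1..<k] (heisenberg MA j (w j) ?\<psi>) = \<phi>"
    unfolding split(1) compose_all_append heisenberg_def \<phi>_def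
    using unitary_operator_inv(2)[OF E[OF sub(1)] Pcl[of j, OF _ cl[OF E[OF sub(1)] \<psi>]]]
    by (simp add: compose_all_snoc[of _ "[]", simplified])
  then have "heisenberg MA k (w k) (heisenberg MA j (w j) ?\<psi>) = inv_into (ell2 ?X) (?E [1..<k]) (\<lambda>x. 0)"
    by (simp add: heisenberg_def[of MA k] null)
  also have "\<dots> = (\<lambda>x. 0)"
    by (rule linear_operator_zero[OF unitary_operator_linear[OF unitary_operator_inverse[OF E[OF sub(4)]]]])
  finally show ?thesis .
qed


section \<open>Inferences obtained without outcomes\<close>

text \<open>
  Without outcome statements no agent ever knows a premise, so nothing is detached and only
  combinations of atomic inferences are known.
\<close>

fun inference_combination :: "'b multi_agent_setup \<Rightarrow> fm \<Rightarrow> bool" where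
  "inference_combination MA (At \<phi> s) \<longleftrightarrow> At \<phi> s \<in> atomic_inferences MA"
| "inference_combination MA (Imp \<phi> \<psi>) \<longleftrightarrow> (\<exists>s. At (Imp \<phi> \<psi>) s \<in> atomic_inferences MA)"
| "inference_combination MA (And \<phi> \<psi>) \<longleftrightarrow> inference_combination MA \<phi> \<and> inference_combination MA \<psi>"
| "inference_combination MA _ \<longleftrightarrow> False"

text \<open>Induction over derivations. With no outcome given, \<open>outcome\<close> cannot fire,
  and \<open>stored\<close>, \<open>part\<close>, \<open>merge\<close> and \<open>exclude\<close>
  lack their premise of the form \<open>Is v\<close>.\<close>

lemma knows_inference_combination:
  assumes "knows MA \<Omega> p \<phi>" "\<Omega> = {}"
  shows "inference_combination MA \<phi>"
  using assms
proof (induction rule: knows.induct)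
  case (inference \<phi> p)
  then show ?case by (auto simp: atomic_inferences_def)
next
  case (unlabel p \<phi> s)
  then show ?case by (auto simp: atomic_inferences_def)
next
  \<comment> \<open>Vacuous: an atomic inference has a premise of the form \<open>Is l\<close>,
    which is never a known conjunct.\<close>
  case (detach p \<phi> \<psi>)
  then show ?case by (auto simp: atomic_inferences_def)
qed auto

section \<open>From certain inferences to vanishing operator products\<close>

lemma prob_eq_zero:
  assumes "prob MA s E = 0" "w \<in> PiE {i \<in> agents MA. s i = 1} (outs MA)" "E w"
    and "\<And>i. i \<in> agents MA \<Longrightarrow> finite (outs MA i)"
  shows "joint_prob MA s w = 0"
proof -
  have "finite (PiE {i \<in> agents MA. s i = 1} (outs MA))"
    using assms(4) by (intro finite_PiE) (auto simp: agents_def)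
  \<comment> \<open>Finiteness is essential: a \<open>sum\<close> over an infinite set would be 0 by
    convention and say nothing about its terms.\<close>
  then have "finite {w \<in> PiE {i \<in> agents MA. s i = 1} (outs MA). E w}" by simp
  then show ?thesis
    using assms(1-3) unfolding prob_def by (subst (asm) sum_eq_0_iff) auto
qed

text \<open>Brings both alternatives in \<open>atomic_inferences\<close> to the second form. The
  probability of the premise splits as \<open>r = p + q\<close>, so \<open>p = r\<close> leaves
  \<open>q = 0\<close>.\<close>

lemma default_prediction_one:
  assumes "default_prediction MA j l = 1"
    and "\<And>i. i \<in> agents MA \<Longrightarrow> finite (outs MA i)"
  shows "prob MA (default_settings (dom j \<union> dom l)) (\<lambda>w. \<not> holds j w \<and> holds l w) = 0"
proof -
  let ?s = "default_settings (dom j \<union> dom l)"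
  let ?W = "PiE {i \<in> agents MA. ?s i = 1} (outs MA)"
  define p where "p = prob MA ?s (\<lambda>w. holds j w \<and> holds l w)"
  define q where "q = prob MA ?s (\<lambda>w. \<not> holds j w \<and> holds l w)"
  define r where "r = prob MA ?s (holds l)"
  have fin: "finite ?W"
    using assms(2) by (intro finite_PiE) (auto simp: agents_def)
  have "{w. w \<in> ?W \<and> holds l w} =
      {w. w \<in> ?W \<and> holds j w \<and> holds l w} \<union> {w. w \<in> ?W \<and> \<not> holds j w \<and> holds l w}" by auto
  then have r_sum: "r = p + q"
    unfolding p_def q_def r_def prob_def
    by (simp only:) (rule sum.union_disjoint, use fin in auto)
  have "p / r = 1"
    using assms(1) by (simp add: default_prediction_def p_def r_def Let_def)
  \<comment> \<open>In \<open>ennreal\<close>, division by 0 gives 0 or \<open>top\<close> and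
    division by \<open>top\<close> gives 0, never 1.\<close>
  then have r: "r \<noteq> 0" "r \<noteq> top"
    by (auto split: if_splits)
  then have "r = p / r * r" using \<open>p / r = 1\<close> by simp
  also have "\<dots> = p" using r by (simp add: ennreal_divide_times ennreal_divide_self less_top)
  finally have pr: "p = r" by simp
  have "p + q = p + 0" using r_sum pr by (simp only: add_0_right)
  then have "p = \<infinity> \<or> q = 0" by (rule ennreal_add_left_cancel[THEN iffD1])
  then have "q = 0" using r pr by auto
  then show ?thesis by (simp only: q_def)
qed

text \<open>The joint outcome violating the inference has probability 0. The operator product is in
  the order of measurement, which need not be the direction of the inference, hence the
  disjunction.\<close>

lemma known_inference_annihilates:
  assumes qs: "quantum_setup MA" and kn: "knows MA {} p (Imp (Is [j \<mapsto> a]) (Is [k \<mapsto> b]))"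
    and c: "c \<in> outs MA k" "c \<noteq> b" and f: "f \<in> ell2 (total_space MA)"
  shows "j < k \<and> heisenberg MA k c (heisenberg MA j a (init MA f)) = (\<lambda>x. 0) \<or>
    k < j \<and> heisenberg MA j a (heisenberg MA k c (init MA f)) = (\<lambda>x. 0)"
proof -
  have fin: "finite (outs MA i)" if "i \<in> agents MA" for i
    using qs that by (auto simp: quantum_setup_def projective_measurement_def)
  let ?s = "default_settings {j, k}"
  have "inference_combination MA (Imp (Is [j \<mapsto> a]) (Is [k \<mapsto> b]))"
    using knows_inference_combination[OF kn refl] .
  then have j: "j \<in> agents MA" "a \<in> outs MA j" and k: "k \<in> agents MA" and neq: "j \<noteq> k"
    and disj: "default_prediction MA [k \<mapsto> b] [j \<mapsto> a] = 1 \<or>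
      prob MA ?s (\<lambda>w. \<not> holds [k \<mapsto> b] w \<and> holds [j \<mapsto> a] w) = 0"
    by (auto simp: atomic_inferences_def valid_asg_def insert_commute)
  from disj have null: "prob MA ?s (\<lambda>w. \<not> holds [k \<mapsto> b] w \<and> holds [j \<mapsto> a] w) = 0"
    using default_prediction_one[OF _ fin, of "[k \<mapsto> b]" "[j \<mapsto> a]"]
    by (auto simp: insert_commute)
  \<comment> \<open>The violating outcome: the premise holds and \<open>k\<close> shows
    \<open>c\<close> instead of \<open>b\<close>. The restriction places it in the extensional
    \<open>PiE\<close>.\<close>
  define w where "w = restrict (\<lambda>i. if i = j then a else c) {j, k}"
  have w: "w j = a" "w k = c" using neq by (simp_all add: w_def)
  have "{i \<in> agents MA. ?s i = 1} = {j, k}"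
    using j k by (auto simp: default_settings_def)
  then have zero: "joint_prob MA ?s w = 0"
    using c j neq by (intro prob_eq_zero[OF null _ _ fin]) (auto simp: w_def holds_def)
  show ?thesis
  proof (cases "j < k")
    case True
    then show ?thesis
      using joint_prob_zero[OF qs j(1) k True _ _ zero f] c j w by simp
  next
    case False
    then have "k < j" using neq by simp
    then show ?thesis
      using joint_prob_zero[OF qs k j(1) _ _ _ _ f, of w] zero c j w by (simp add: insert_commute)
  qed
qed

text \<open>With two outcomes per agent, the violations of both inferences are exactly the two
  vanishing products in \<open>binary_measurements_agree\<close>.\<close>

lemma opposite_inferences_agree:
  assumes qs: "quantum_setup MA"
    and j: "j \<in> agents MA" "outs MA j = {a, a'}" "a \<noteq> a'"
    and k: "k \<in> agents MA" "outs MA k = {b, b'}" "b \<noteq> b'"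
    and kn: "knows MA {} p (Imp (Is [j \<mapsto> a]) (Is [k \<mapsto> b]))"
      "knows MA {} p' (Imp (Is [j \<mapsto> a']) (Is [k \<mapsto> b']))"
    and f: "f \<in> ell2 (total_space MA)"
  shows "heisenberg MA j a (init MA f) = heisenberg MA k b (init MA f)"
proof -
  have \<psi>: "init MA f \<in> ell2 (total_space MA)"
    using qs f by (auto simp: quantum_setup_def density_operator_def linear_operator_closed)
  have Q: "projective_measurement (total_space MA) {a, a'} (heisenberg MA j)"
    "projective_measurement (total_space MA) {b, b'} (heisenberg MA k)"
    using projective_heisenberg[OF qs] j k by metis+
  have null: "j < k \<and> heisenberg MA k b' (heisenberg MA j a (init MA f)) = (\<lambda>x. 0) \<or>
      k < j \<and> heisenberg MA j a (heisenberg MA k b' (init MA f)) = (\<lambda>x. 0)"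
    "j < k \<and> heisenberg MA k b (heisenberg MA j a' (init MA f)) = (\<lambda>x. 0) \<or>
      k < j \<and> heisenberg MA j a' (heisenberg MA k b (init MA f)) = (\<lambda>x. 0)"
    using known_inference_annihilates[OF qs kn(1) _ _ f, of b']
      known_inference_annihilates[OF qs kn(2) _ _ f, of b] k by auto
  show ?thesis
  proof (cases "j < k")
    case True
    then show ?thesis
      using binary_measurements_agree[OF Q(1) j(3) Q(2) k(3) \<psi>] null by simp
  next
    case False
    \<comment> \<open>Here \<open>k\<close> measures first; the same two zeros fit with the roles of
      \<open>j\<close> and \<open>k\<close> exchanged.\<close>
    then show ?thesis
      using binary_measurements_agree[OF Q(2) k(3) Q(1) j(3) \<psi>] null by simp
  qed
qed

text \<open>The cycle is cut open at \<open>i\<close>, which carries the value \<open>b\<close> as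
  starting point and \<open>G i\<close> as end point; each link hands the value on
  unchanged.\<close>

lemma cycle_agreement:
  assumes i: "i \<in> {1..n}"
    and link: "\<And>k. k \<in> {1..n} \<Longrightarrow> (G(i := b)) k = G (next_agent n k)"
  shows "b = G i"
proof -
  have up: "G k = b" if "Suc i \<le> k" "k \<le> n" for k
    using that
  proof (induction k rule: dec_induct)
    case base
    then show ?case using link[of i] i by (simp add: next_agent_def)
  next
    case (step k)
    then show ?case using link[of k] by (simp add: next_agent_def)
  qed
  \<comment> \<open>For \<open>i = n\<close> the range of \<open>up\<close> is empty, and the link
    leaving \<open>i\<close> already leads to 1.\<close>
  have wrap: "G 1 = b"
    using link[of n] up[of n] i by (cases "i = n") (auto simp: next_agent_def)
  have "G k = b" if "1 \<le> k" "k \<le> i" for k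
    using that
  proof (induction k rule: dec_induct)
    case base
    show ?case by (rule wrap)
  next
    case (step k)
    then show ?case
      using link[of k] i by (auto simp: next_agent_def split: if_splits)
  qed
  with i show ?thesis by simp
qed

theorem corollary3:
  fixes n :: nat
  assumes "n \<ge> 3"
  shows "\<not> (\<exists>MA :: 'b multi_agent_setup. post_selection_free_cycle_paradox n MA)"
proof
  assume "\<exists>MA :: 'b multi_agent_setup. post_selection_free_cycle_paradox n MA"
  then obtain MA :: "'b multi_agent_setup" and i v v' where cyc: "cycle_setup n MA"
    and i: "i \<in> {1..n}"
    and v: "\<And>k. k \<in> {1..n} - {i} \<Longrightarrow> v k \<in> {0, 1} \<and> v' k \<in> {0, 1} \<and> v k \<noteq> v' k"
    and chain: "inference_chain n MA i 0 v 1" "inference_chain n MA i 1 v' 0"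
    unfolding post_selection_free_cycle_paradox_def by blast
  have qs: "quantum_setup MA" and ag: "agents MA = {1..n}"
    and outs: "\<And>k. k \<in> {1..n} \<Longrightarrow> outs MA k = {0, 1}"
    using cyc by (auto simp: cycle_setup_def agents_def)
  have dens: "density_operator (total_space MA) (init MA)"
    using qs by (simp add: quantum_setup_def)
  then obtain f where f: "f \<in> ell2 (total_space MA)" and nz: "init MA f \<noteq> (\<lambda>x. 0)"
    by (rule density_operator_nonzero)
  let ?\<psi> = "init MA f"
  have \<psi>: "?\<psi> \<in> ell2 (total_space MA)"
    using dens f by (auto simp: density_operator_def linear_operator_closed)
  \<comment> \<open>The branches of the state along the first chain, with its end value 1 at
    \<open>i\<close>; the start value 0 enters as the update of \<open>G\<close> below.\<close>
  define G where "G k = heisenberg MA k ((v(i := 1)) k) ?\<psi>" for k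
  \<comment> \<open>At each agent the two chains together exhaust the outcomes, also at
    \<open>i\<close>, both for the start values and for the end values.\<close>
  have opposite: "{0, 1} = {(v(i := 0)) k, (v'(i := 1)) k}" "(v(i := 0)) k \<noteq> (v'(i := 1)) k"
      "{0, 1} = {(v(i := 1)) k, (v'(i := 0)) k}" "(v(i := 1)) k \<noteq> (v'(i := 0)) k"
    if "k \<in> {1..n}" for k
  proof -
    have "v k = 0 \<and> v' k = 1 \<or> v k = 1 \<and> v' k = 0" if "k \<noteq> i"
      using v[of k] \<open>k \<in> {1..n}\<close> that by auto
    then show "{0, 1} = {(v(i := 0)) k, (v'(i := 1)) k}" "(v(i := 0)) k \<noteq> (v'(i := 1)) k"
      "{0, 1} = {(v(i := 1)) k, (v'(i := 0)) k}" "(v(i := 1)) k \<noteq> (v'(i := 0)) k"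
      by (cases "k = i"; force simp: insert_commute)+
  qed
  have "(G(i := heisenberg MA i 0 ?\<psi>)) k = G (next_agent n k)" if k: "k \<in> {1..n}" for k
  proof -
    have nx: "next_agent n k \<in> {1..n}" using k by (auto simp: next_agent_def)
    obtain A where A: "knows MA {} [A]
        (Imp (Is [k \<mapsto> (v(i := 0)) k]) (Is [next_agent n k \<mapsto> (v(i := 1)) (next_agent n k)]))"
      using chain(1) k unfolding inference_chain_def by blast
    obtain A' where A': "knows MA {} [A']
        (Imp (Is [k \<mapsto> (v'(i := 1)) k]) (Is [next_agent n k \<mapsto> (v'(i := 0)) (next_agent n k)]))"
      using chain(2) k unfolding inference_chain_def by blast
    have 1: "outs MA k = {(v(i := 0)) k, (v'(i := 1)) k}" "(v(i := 0)) k \<noteq> (v'(i := 1)) k"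
      by (rule trans[OF outs[OF k] opposite(1)[OF k]], rule opposite(2)[OF k])
    have 2: "outs MA (next_agent n k) =
        {(v(i := 1)) (next_agent n k), (v'(i := 0)) (next_agent n k)}"
      "(v(i := 1)) (next_agent n k) \<noteq> (v'(i := 0)) (next_agent n k)"
      by (rule trans[OF outs[OF nx] opposite(3)[OF nx]], rule opposite(4)[OF nx])
    have "heisenberg MA k ((v(i := 0)) k) ?\<psi> = G (next_agent n k)"
      unfolding G_def
      by (rule opposite_inferences_agree[OF qs _ 1 _ 2 A A' f]) (use k nx ag in simp_all)
    then show ?thesis by (cases "k = i") (simp_all add: G_def)
  qed
  then have "heisenberg MA i 0 ?\<psi> = G i"
    by (rule cycle_agreement[OF i])
  then have eq: "heisenberg MA i 0 ?\<psi> = heisenberg MA i 1 ?\<psi>"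
    by (simp add: G_def)
  have Q: "projective_measurement (total_space MA) {0, 1} (heisenberg MA i)"
    using projective_heisenberg[OF qs] i ag outs by metis
  have "heisenberg MA i 0 (heisenberg MA i 0 ?\<psi>) = heisenberg MA i 0 ?\<psi>"
    using Q \<psi> by (simp add: projective_measurement_def projector_def)
  moreover have "heisenberg MA i 0 (heisenberg MA i 1 ?\<psi>) = (\<lambda>x. 0)"
    using Q \<psi> by (simp add: projective_measurement_def)
  ultimately have zero: "heisenberg MA i 0 ?\<psi> = (\<lambda>x. 0)"
    using eq by simp
  have "?\<psi> = (\<lambda>x. heisenberg MA i 0 ?\<psi> x + heisenberg MA i 1 ?\<psi> x)"
    using Q \<psi> by (simp add: projective_measurement_def)
  then have "?\<psi> = (\<lambda>x. 0)"
    unfolding eq[symmetric] zero by simp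
  with nz show False by simp
qed

end
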